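(* Let $p\in[1,\infty)$ and let $(\epsilon_n)$ be a sequence with $\epsilon_n\downarrow0$ and $\epsilon_n\ge\sqrt{(\log n)/n}$. Assume that the prior satisfies $\Pi_n(\mathcal K_n)\ge e^{-n\epsilon_n^2}$ for all large enough $n$, where $$\mathcal K_n=\Big\{q\in\mathcal F:\int\log\frac{p_0}{q}\,dP_0\le\epsilon_n^2,\ \int\Big(\log\frac{p_0}{q}\Big)^2dP_0\le\epsilon_n^2\Big\}.$$ Furthermore, assume that there exist positive constants $K$ and $\delta$ such that $M_{2p+\delta}(P_0)<\infty$ and $$\Pi_n\big(M_{2p+\delta}(P)\le K\mid X_1,\ldots,X_n\big)\to1\quad\text{in probability.}$$ Then, for some constant $K'>0$, $$\Pi_n\Big(W_p^p(P,P_0)\ge K'\big\{\epsilon_n+I(p=1)\,\epsilon_n\log\epsilon_n^{-1}\big\}\ \Big|\ X_1,\ldots,X_n\Big)\to0\quad\text{in probability.}$$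
   Context: Setting: $X_1,X_2,\ldots$ are i.i.d. real random variables from a true distribution $P_0$ having a Lebesgue density $p_0$ on $\mathbb R$. $\mathcal F$ is a collection of probability densities on $\mathbb R$ equipped with the weak topology, and $\Pi=\Pi_n$ is a prior (a probability measure on $\mathcal F$), which may depend on the sample size $n$. For a measurable $A\subset\mathcal F$ the posterior probability is $$\Pi_n(A\mid X_1,\ldots,X_n)=\frac{\int_A\prod_{i=1}^n q(X_i)/p_0(X_i)\,d\Pi_n(q)}{\int_{\mathcal F}\prod_{i=1}^n q(X_i)/p_0(X_i)\,d\Pi_n(q)}.$$ A density is identified with its probability measure, and $P$ inside $\Pi_n(\cdot\mid X_1,\ldots,X_n)$ denotes the random probability measure whose density is drawn from the posterior. Convergence in probability is with respect to the true distribution $P_0$ of the data, as $n\to\infty$. Constants do not depend on $n$. Notation: $M_r(P)=\int|x|^r\,dP(x)$; $W_p(P,Q)=\inf_{\pi}\big(\int_{\mathbb R^2}|x-y|^p\,d\pi(x,y)\big)^{1/p}$, the infimum being over all couplings $\pi$ of $P$ and $Q$ (Borel probability measures on $\mathbb R^2$ with marginals $P$ and $Q$); $W_p^p=(W_p)^p$; $I(p=1)$ equals $1$ if $p=1$ and $0$ otherwise. *)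

theory Defs
  imports "HOL-Probability.Probability"
begin

section \<open>Densities and the weak topology\<close>

definition prob_density :: "(real \<Rightarrow> real) \<Rightarrow> bool" where
  "prob_density q \<longleftrightarrow>
     q \<in> borel_measurable borel \<and> (\<forall>x. 0 \<le> q x) \<and> (\<integral>\<^sup>+x. ennreal (q x) \<partial>lborel) = 1"

definition law :: "(real \<Rightarrow> real) \<Rightarrow> real measure" where
  "law q = density lborel (\<lambda>x. ennreal (q x))"

text \<open>Each density stands for its law, so this is the coarsest topology on \<open>F\<close> that makes
  \<open>q \<mapsto> \<integral> f dP\<close>, with \<open>P\<close> the law of \<open>q\<close>, continuous for every bounded continuous \<open>f\<close>.\<close>

definition weak_topology :: "(real \<Rightarrow> real) set \<Rightarrow> (real \<Rightarrow> real) topology" where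
  "weak_topology F = topology_generated_by
     {{q \<in> F. (\<integral>x. f x \<partial>law q) \<in> U} | f U. f \<in> (bcontfun :: (real \<Rightarrow> real) set) \<and> open U}"

lemma topspace_weak_topology [simp]: "topspace (weak_topology F) = F"
proof -
  have "(\<lambda>_. 0) \<in> (bcontfun :: (real \<Rightarrow> real) set)"
    by (simp add: bcontfun_def)
  then have "F \<in> {{q \<in> F. (\<integral>x. f x \<partial>law q) \<in> U} | f U.
      f \<in> (bcontfun :: (real \<Rightarrow> real) set) \<and> open U}"
    by (intro CollectI exI[of _ "\<lambda>_. 0"] exI[of _ UNIV]) auto
  then show ?thesis
    by (auto simp: weak_topology_def)
qed

definition weak_borel :: "(real \<Rightarrow> real) set \<Rightarrow> (real \<Rightarrow> real) measure" where
  "weak_borel F = sigma F {U. openin (weak_topology F) U}"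

lemma space_weak_borel [simp]: "space (weak_borel F) = F"
  unfolding weak_borel_def
  by (intro space_measure_of) (use openin_subset in fastforce)

text \<open>A collection of densities. A density is determined by its law only almost everywhere, so one
  has to say which versions are used when a density is evaluated at a point. As is standard,
  these are chosen so that \<open>(q, x) \<mapsto> q x\<close> is jointly measurable: this is always possible, and
  it is what makes the likelihood a measurable function on \<open>F\<close>. It also implies that \<open>F\<close>
  contains one version only of each of its members.\<close>

definition density_model :: "(real \<Rightarrow> real) set \<Rightarrow> bool" where
  "density_model F \<longleftrightarrow>
     (\<forall>q\<in>F. prob_density q) \<and>
     (\<lambda>(q, x). q x) \<in> borel_measurable (weak_borel F \<Otimes>\<^sub>M borel)"

definition prior_on :: "(real \<Rightarrow> real) set \<Rightarrow> (real \<Rightarrow> real) measure \<Rightarrow> bool" where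
  "prior_on F \<mu> \<longleftrightarrow> prob_space \<mu> \<and> sets \<mu> = sets (weak_borel F)"

section \<open>Posterior\<close>

text \<open>The observations entering the posterior are \<open>x 1, \<dots>, x n\<close>. The integrals are taken in
  \<open>[0, \<infinity>]\<close>, where a quotient with denominator \<open>0\<close> and numerator \<open>0\<close> is \<open>0\<close>.\<close>

definition likelihood_ratio ::
    "(real \<Rightarrow> real) \<Rightarrow> nat \<Rightarrow> (nat \<Rightarrow> real) \<Rightarrow> (real \<Rightarrow> real) \<Rightarrow> real" where
  "likelihood_ratio p0 n x q = (\<Prod>i=1..n. q (x i) / p0 (x i))"

definition posterior ::
    "(real \<Rightarrow> real) \<Rightarrow> (real \<Rightarrow> real) measure \<Rightarrow> nat \<Rightarrow> (nat \<Rightarrow> real) \<Rightarrow> (real \<Rightarrow> real) set \<Rightarrow> real"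
  where
  "posterior p0 \<mu> n x A = enn2real (
     (\<integral>\<^sup>+q\<in>A. ennreal (likelihood_ratio p0 n x q) \<partial>\<mu>) /
     (\<integral>\<^sup>+q. ennreal (likelihood_ratio p0 n x q) \<partial>\<mu>))"

definition conv_in_prob :: "'w measure \<Rightarrow> (nat \<Rightarrow> 'w \<Rightarrow> real) \<Rightarrow> real \<Rightarrow> bool" where
  "conv_in_prob M Y c \<longleftrightarrow>
     (\<forall>e>0. (\<lambda>n. measure M {\<omega> \<in> space M. \<bar>Y n \<omega> - c\<bar> > e}) \<longlonglongrightarrow> 0)"

section \<open>Kullback--Leibler neighbourhoods\<close>

text \<open>\<open>log (a / b)\<close> with the convention \<open>log (a / 0) = \<infinity>\<close>; in HOL, \<open>ln (a / 0) = 0\<close>. The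
  value at \<open>a = 0\<close> is irrelevant, as \<open>p0\<close> vanishes on a null set of its law only.\<close>

definition log_ratio :: "real \<Rightarrow> real \<Rightarrow> ereal" where
  "log_ratio a b = (if b = 0 then \<infinity> else ereal (ln (a / b)))"

text \<open>The integral as the difference of the integrals of the positive and the negative part
  (\<open>e2ennreal\<close> sends negative arguments to \<open>0\<close>). Bochner's integral would be \<open>0\<close> on
  non-integrable functions. Below, the negative part always has a finite integral.\<close>

definition ext_integral :: "'a measure \<Rightarrow> ('a \<Rightarrow> ereal) \<Rightarrow> ereal" where
  "ext_integral M f =
     enn2ereal (\<integral>\<^sup>+x. e2ennreal (f x) \<partial>M) - enn2ereal (\<integral>\<^sup>+x. e2ennreal (- f x) \<partial>M)"

definition KL_nbhd :: "(real \<Rightarrow> real) set \<Rightarrow> (real \<Rightarrow> real) \<Rightarrow> real \<Rightarrow> (real \<Rightarrow> real) set" where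
  "KL_nbhd F p0 e = {q \<in> F.
     ext_integral (law p0) (\<lambda>x. log_ratio (p0 x) (q x)) \<le> ereal (e\<^sup>2) \<and>
     ext_integral (law p0) (\<lambda>x. (log_ratio (p0 x) (q x))\<^sup>2) \<le> ereal (e\<^sup>2)}"

section \<open>Moments and Wasserstein distances\<close>

definition abs_moment :: "real \<Rightarrow> real measure \<Rightarrow> ennreal" where
  "abs_moment r P = (\<integral>\<^sup>+x. ennreal (\<bar>x\<bar> powr r) \<partial>P)"

definition couplings :: "real measure \<Rightarrow> real measure \<Rightarrow> (real \<times> real) measure set" where
  "couplings P Q = {\<pi>. sets \<pi> = sets borel \<and> distr \<pi> borel fst = P \<and> distr \<pi> borel snd = Q}"

text \<open>Real powers on \<open>[0, \<infinity>]\<close>, for positive exponents.\<close>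

definition ennreal_rpow :: "ennreal \<Rightarrow> real \<Rightarrow> ennreal" where
  "ennreal_rpow a r = (if a = \<infinity> then \<infinity> else ennreal (enn2real a powr r))"

definition wasserstein :: "real \<Rightarrow> real measure \<Rightarrow> real measure \<Rightarrow> ennreal" where
  "wasserstein p P Q = (INF \<pi>\<in>couplings P Q.
     ennreal_rpow (\<integral>\<^sup>+(x, y). ennreal (\<bar>x - y\<bar> powr p) \<partial>\<pi>) (1 / p))"

end

theory Submission
  imports Defs
begin

text \<open>
  The quantile coupling gives \<open>W_p^p(P, Q) \<le> 4^p \<integral> (1 + |x|)^(p-1) |F_P(x) - F_Q(x)| dx\<close>. Let \<open>\<nu>\<close>
  be the probability measure with density proportional to \<open>(1 + |x|)^(-1-\<delta>/2)\<close> and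
  \<open>\<tau>(x) = (1 + |x|)^(p+\<delta>/2)\<close>; the right-hand side is a multiple of \<open>\<integral> \<tau> |F_P - F_Q| d\<nu>\<close>. The moments of
  order \<open>2p + \<delta>\<close> bound \<open>\<tau>\<^sup>2 F(1 - F)\<close>, the scaled variance of the empirical distribution function \<open>F_n\<close>.
  The part where \<open>\<epsilon>\<tau> > 1\<close> contributes \<open>O(\<epsilon>)\<close> by these tail bounds. On the part where \<open>\<epsilon>\<tau> \<le> 1\<close>, one
  compares both distribution functions with \<open>F_n\<close>: by Bernstein's estimate of the moment generating
  function, applied for each \<open>x\<close>, \<open>\<integral> exp (n \<epsilon> \<tau> |F_n - F_Q|) d\<nu>\<close> has expectation at most \<open>2 exp (C n \<epsilon>\<^sup>2)\<close>
  under \<open>Q\<close>, and Jensen's inequality turns this into a deviation bound for \<open>\<integral> \<tau> |F_n - F_Q| d\<nu>\<close>. This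
  needs neither tests nor a grid, and produces no logarithmic term even for \<open>p = 1\<close>. The denominator of the
  posterior is at least \<open>exp (-3 n \<epsilon>\<^sup>2) / 2\<close> with high probability, by Chebyshev's inequality for each \<open>q\<close>
  in the Kullback--Leibler neighbourhood, followed by Fubini's theorem and Markov's inequality.
\<close>

section \<open>Wasserstein distance and distribution functions\<close>

lemma (in real_distribution) borel_measurable_cdf [measurable]: "cdf M \<in> borel_measurable borel"
  by (intro borel_measurable_mono monoI cdf_nondecreasing)

text \<open>A quarter of the interval, of length \<open>d\<close>, stays at distance at least
  \<open>d\<close> from the origin. The weight is at least \<open>d powr (p - 1)\<close> there, so
  the integral is at least \<open>d powr p\<close>; the factor \<open>4 powr p\<close> undoes the
  passage to a quarter.\<close>

lemma powr_diff_le_nn_integral: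
  fixes a b p :: real
  assumes "a < b" "p \<ge> 1"
  shows "ennreal ((b - a) powr p) \<le>
    ennreal (4 powr p) * (\<integral>\<^sup>+x\<in>{a..<b}. ennreal ((1 + \<bar>x\<bar>) powr (p - 1)) \<partial>lborel)"
proof -
  define d where "d = (b - a) / 4"
  have d: "d > 0" and b: "b = a + 4 * d" using assms by (simp_all add: d_def field_simps)
  \<comment> \<open>The quarter is taken at the endpoint of larger modulus: the right one if the
    midpoint is nonnegative, the left one otherwise.\<close>
  obtain c where c: "{c..<c + d} \<subseteq> {a..<b}" "\<And>x. x \<in> {c..<c + d} \<Longrightarrow> d \<le> \<bar>x\<bar>"
  proof (cases "a + b \<ge> 0")
    case True
    show ?thesis
      by (rule that[of "b - d"]) (use True d b in auto)
  next
    case False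
    show ?thesis
      by (rule that[of a]) (use False d b in auto)
  qed
  have "ennreal (d powr p) = ennreal (d powr (p - 1)) * ennreal d"
    using d by (simp flip: ennreal_mult add: powr_mult_base mult.commute)
  also have "ennreal d = emeasure lborel {c..<c + d}"
    using d by simp
  also have "ennreal (d powr (p - 1)) * \<dots> = (\<integral>\<^sup>+x\<in>{c..<c + d}. ennreal (d powr (p - 1)) \<partial>lborel)"
    by (simp add: nn_integral_cmult_indicator)
  also have "\<dots> \<le> (\<integral>\<^sup>+x\<in>{a..<b}. ennreal ((1 + \<bar>x\<bar>) powr (p - 1)) \<partial>lborel)"
  proof (rule nn_integral_mono)
    fix x
    show "ennreal (d powr (p - 1)) * indicator {c..<c + d} x
        \<le> ennreal ((1 + \<bar>x\<bar>) powr (p - 1)) * indicator {a..<b} x"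
    proof (cases "x \<in> {c..<c + d}")
      case True
      then have "d \<le> 1 + \<bar>x\<bar>" using c(2)[of x] by linarith
      then have "d powr (p - 1) \<le> (1 + \<bar>x\<bar>) powr (p - 1)"
        using d assms by (intro powr_mono2) auto
      moreover have "x \<in> {a..<b}" using True c by blast
      ultimately show ?thesis using True by (simp add: ennreal_leI)
    qed simp
  qed
  finally have "ennreal (4 powr p) * ennreal (d powr p) \<le>
      ennreal (4 powr p) * (\<integral>\<^sup>+x\<in>{a..<b}. ennreal ((1 + \<bar>x\<bar>) powr (p - 1)) \<partial>lborel)"
    by (intro mult_left_mono) auto
  moreover have "(b - a) powr p = 4 powr p * d powr p"
    using d b by (simp flip: powr_mult)
  ultimately show ?thesis by (simp add: ennreal_mult)
qed

lemma ennreal_rpow_wasserstein_le_coupling: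
  assumes "\<pi> \<in> couplings P Q" "p > 0"
  shows "ennreal_rpow (wasserstein p P Q) p \<le> (\<integral>\<^sup>+(x, y). ennreal (\<bar>x - y\<bar> powr p) \<partial>\<pi>)"
proof (cases "(\<integral>\<^sup>+(x, y). ennreal (\<bar>x - y\<bar> powr p) \<partial>\<pi>)")
  case (real r)
  have "wasserstein p P Q \<le> ennreal_rpow (\<integral>\<^sup>+(x, y). ennreal (\<bar>x - y\<bar> powr p) \<partial>\<pi>) (1 / p)"
    unfolding wasserstein_def using assms(1) by (rule INF_lower)
  also have "\<dots> = ennreal (r powr (1 / p))"
    using real by (simp add: ennreal_rpow_def)
  finally have w: "wasserstein p P Q \<le> ennreal (r powr (1 / p))" .
  then obtain w where w': "wasserstein p P Q = ennreal w" "w \<ge> 0"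
    by (cases "wasserstein p P Q") (auto simp: top_unique)
  with w have "w \<le> r powr (1 / p)" by simp
  then have "w powr p \<le> (r powr (1 / p)) powr p"
    using w' assms by (intro powr_mono2) auto
  also have "\<dots> = r" using real assms by (simp add: powr_powr)
  finally show ?thesis using w' real by (simp add: ennreal_rpow_def ennreal_leI)
qed simp

text \<open>For \<open>u\<close> uniform on the unit interval, the pair of quantiles
  \<open>(P.I u, Q.I u)\<close> is a coupling. Its cost at \<open>u\<close> is bounded by the weight
  integrated over the interval between the two quantiles. After the integrals are exchanged, the
  inner one at fixed \<open>x\<close> measures the set of \<open>u\<close> whose quantiles enclose
  \<open>x\<close>, and this measure is the gap between the distribution functions at
  \<open>x\<close>.\<close>

lemma ennreal_rpow_wasserstein_le_cdf:
  fixes P Q :: "real measure"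
  assumes "real_distribution P" "real_distribution Q" "p \<ge> 1"
  shows "ennreal_rpow (wasserstein p P Q) p \<le>
    ennreal (4 powr p) * (\<integral>\<^sup>+x. ennreal ((1 + \<bar>x\<bar>) powr (p - 1) * \<bar>cdf P x - cdf Q x\<bar>) \<partial>lborel)"
proof -
  interpret P: cdf_distribution P unfolding cdf_distribution_def by fact
  interpret Q: cdf_distribution Q unfolding cdf_distribution_def by fact
  let ?U = "restrict_space lborel {0<..<1::real}"
  note [measurable] = P.measurable_CI Q.measurable_CI
  have sU: "sets ?U = sets (restrict_space borel {0<..<1})"
    by (simp add: sets_restrict_space)
  have [measurable]: "P.I \<in> borel_measurable ?U" "Q.I \<in> borel_measurable ?U"
    by (simp_all add: measurable_cong_sets[OF sU refl])
  interpret U: prob_space ?U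
    by (auto simp: emeasure_restrict_space space_restrict_space intro!: prob_spaceI)
  define \<pi> where "\<pi> = distr ?U (borel :: (real \<times> real) measure) (\<lambda>u. (P.I u, Q.I u))"
  have m: "(\<lambda>u. (P.I u, Q.I u)) \<in> ?U \<rightarrow>\<^sub>M borel"
    unfolding borel_prod[symmetric] by measurable
  have f1: "(fst :: real \<times> real \<Rightarrow> real) \<in> borel_measurable borel"
    and f2: "(snd :: real \<times> real \<Rightarrow> real) \<in> borel_measurable borel"
    unfolding borel_prod[symmetric] by measurable
  have cpl: "\<pi> \<in> couplings P Q"
    using P.distr_I_eq_M Q.distr_I_eq_M
    by (auto simp: couplings_def \<pi>_def distr_distr[OF f1 m] distr_distr[OF f2 m] comp_def)
  have diff: "(\<lambda>(x, y). ennreal (\<bar>x - y\<bar> powr p)) \<in> borel_measurable (borel :: (real \<times> real) measure)"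
    unfolding borel_prod[symmetric] by measurable
  let ?w = "\<lambda>x::real. ennreal ((1 + \<bar>x\<bar>) powr (p - 1))"
  let ?B = "\<lambda>u x. indicator {min (P.I u) (Q.I u)..<max (P.I u) (Q.I u)} x :: ennreal"
  have "ennreal_rpow (wasserstein p P Q) p \<le> (\<integral>\<^sup>+(x, y). ennreal (\<bar>x - y\<bar> powr p) \<partial>\<pi>)"
    using cpl assms by (intro ennreal_rpow_wasserstein_le_coupling) auto
  also have "\<dots> = (\<integral>\<^sup>+u. ennreal (\<bar>P.I u - Q.I u\<bar> powr p) \<partial>?U)"
    unfolding \<pi>_def using m diff by (simp add: nn_integral_distr)
  also have "\<dots> \<le> (\<integral>\<^sup>+u. ennreal (4 powr p) * (\<integral>\<^sup>+x. ?w x * ?B u x \<partial>lborel) \<partial>?U)"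
  proof (rule nn_integral_mono)
    fix u
    show "ennreal (\<bar>P.I u - Q.I u\<bar> powr p) \<le> ennreal (4 powr p) * (\<integral>\<^sup>+x. ?w x * ?B u x \<partial>lborel)"
      using powr_diff_le_nn_integral[of "P.I u" "Q.I u" p] powr_diff_le_nn_integral[of "Q.I u" "P.I u" p] assms
      by (cases "P.I u" "Q.I u" rule: linorder_cases) (auto simp: abs_if)
  qed
  also have "\<dots> = ennreal (4 powr p) * (\<integral>\<^sup>+u. (\<integral>\<^sup>+x. ?w x * ?B u x \<partial>lborel) \<partial>?U)"
    unfolding indicator_def
    by (rule nn_integral_cmult) simp
  also have "(\<integral>\<^sup>+u. (\<integral>\<^sup>+x. ?w x * ?B u x \<partial>lborel) \<partial>?U) = (\<integral>\<^sup>+x. (\<integral>\<^sup>+u. ?w x * ?B u x \<partial>?U) \<partial>lborel)"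
    unfolding indicator_def
    by (rule pair_sigma_finite.Fubini'[OF pair_sigma_finite.intro])
       (auto intro: lborel.sigma_finite_measure_axioms U.sigma_finite_measure_axioms)
  also have "\<dots> = (\<integral>\<^sup>+x. ennreal ((1 + \<bar>x\<bar>) powr (p - 1) * \<bar>cdf P x - cdf Q x\<bar>) \<partial>lborel)"
  proof (rule nn_integral_cong)
    fix x :: real
    have "(\<integral>\<^sup>+u. ?w x * ?B u x \<partial>?U) = ?w x * (\<integral>\<^sup>+u. ?B u x \<partial>?U)"
      unfolding indicator_def by (rule nn_integral_cmult) simp
    also have "(\<integral>\<^sup>+u. ?B u x \<partial>?U) =
        (\<integral>\<^sup>+u. indicator ({min (P.C x) (Q.C x)<..max (P.C x) (Q.C x)} \<inter> {0<..<1}) u \<partial>lborel)"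
    proof (subst nn_integral_restrict_space, goal_cases)
      case 2
      show ?case
      proof (rule nn_integral_cong)
      fix u :: real
      \<comment> \<open>A quantile at \<open>u\<close> is at most \<open>x\<close> exactly when
        \<open>u\<close> is at most the distribution function at \<open>x\<close>. This Galois
        connection is why intervals in \<open>x\<close> are closed on the left and intervals in
        \<open>u\<close> on the right.\<close>
      have "min (P.I u) (Q.I u) \<le> x \<and> x < max (P.I u) (Q.I u) \<longleftrightarrow>
          min (P.C x) (Q.C x) < u \<and> u \<le> max (P.C x) (Q.C x)" if "u \<in> {0<..<1}"
        using P.pseudoinverse[of u x] Q.pseudoinverse[of u x] that
        by (auto simp: min_le_iff_disj le_max_iff_disj less_max_iff_disj min_less_iff_disj not_le)
      then show "?B u x * indicator {0<..<1} u =
          indicator ({min (P.C x) (Q.C x)<..max (P.C x) (Q.C x)} \<inter> {0<..<1}) u"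
        by (auto simp: indicator_def)
      qed
    qed simp
    also have "\<dots> = emeasure lborel ({min (P.C x) (Q.C x)<..max (P.C x) (Q.C x)} \<inter> {0<..<1})"
      by simp
    \<comment> \<open>Restricting \<open>u\<close> to the open unit interval loses at most the
      endpoint 1.\<close>
    also have "\<dots> = emeasure lborel {min (P.C x) (Q.C x)<..max (P.C x) (Q.C x)}"
    proof (rule emeasure_eq_AE)
      have "P.C x \<ge> 0" "Q.C x \<ge> 0" "P.C x \<le> 1" "Q.C x \<le> 1"
        using P.cdf_bounded_prob[of x] Q.cdf_bounded_prob[of x] by (auto simp: P.cdf_nonneg Q.cdf_nonneg)
      then show "AE u in lborel. (u \<in> {min (P.C x) (Q.C x)<..max (P.C x) (Q.C x)} \<inter> {0<..<1}) =
          (u \<in> {min (P.C x) (Q.C x)<..max (P.C x) (Q.C x)})"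
        by (intro eventually_mono[OF AE_lborel_singleton[of 1]]) (auto simp: le_max_iff_disj min_less_iff_disj)
    qed auto
    also have "\<dots> = ennreal \<bar>P.C x - Q.C x\<bar>"
      by (auto simp: min_def max_def abs_if)
    finally show "(\<integral>\<^sup>+u. ?w x * ?B u x \<partial>?U) =
        ennreal ((1 + \<bar>x\<bar>) powr (p - 1) * \<bar>cdf P x - cdf Q x\<bar>)"
      by (simp add: ennreal_mult)
  qed
  finally show ?thesis .
qed

section \<open>Exponential moments of the empirical process\<close>

lemma exp_le_quadratic:
  fixes y :: real
  assumes "\<bar>y\<bar> \<le> 1"
  shows "exp y \<le> 1 + y + y\<^sup>2"
proof (cases "y \<ge> 0")
  case True
  then show ?thesis using assms exp_bound[of y] by simp
next
  case False
  \<comment> \<open>For negative \<open>y\<close> the claim amounts to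
    \<open>1 \<le> (1 + y + y\<^sup>2) * exp (- y)\<close>. Replacing the exponential by its lower
    bound \<open>1 - y\<close> leaves \<open>1 - y ^ 3\<close>, which is at least 1.\<close>
  have "(1 + y + y\<^sup>2) * (1 - y) = 1 - y ^ 3"
    by (simp add: algebra_simps power2_eq_square power3_eq_cube)
  also have "\<dots> \<ge> 1"
    using False by (simp add: power3_eq_cube mult_nonneg_nonpos2 mult_nonpos_nonpos mult_nonneg_nonpos)
  finally have "1 \<le> (1 + y + y\<^sup>2) * (1 - y)" .
  also have "\<dots> \<le> (1 + y + y\<^sup>2) * exp (- y)"
  proof (rule mult_left_mono)
    have "0 \<le> 1 + y" using assms by linarith
    then show "0 \<le> 1 + y + y\<^sup>2" by (simp add: add_nonneg_nonneg)
  qed (use exp_ge_add_one_self[of "- y"] in simp)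
  finally show ?thesis by (simp add: exp_minus field_simps)
qed

text \<open>The left-hand side is the moment generating function of a centred Bernoulli variable. In
  the quadratic bound of \<open>exp\<close> the linear terms cancel and the squares add up to the
  variance. The variance has to survive in the exponent, since its decay in the tails is what
  compensates the growing weight later.\<close>

lemma bernoulli_mgf_le:
  fixes u v :: real
  assumes "\<bar>u\<bar> \<le> 1" "0 \<le> v" "v \<le> 1"
  shows "v * exp (u * (1 - v)) + (1 - v) * exp (- (u * v)) \<le> exp (u\<^sup>2 * (v * (1 - v)))"
proof -
  have "\<bar>u * (1 - v)\<bar> \<le> 1" "\<bar>- (u * v)\<bar> \<le> 1"
    using assms by (auto simp: abs_mult intro: mult_le_one)
  then have "v * exp (u * (1 - v)) + (1 - v) * exp (- (u * v))
      \<le> v * (1 + u * (1 - v) + (u * (1 - v))\<^sup>2) + (1 - v) * (1 + (- (u * v)) + (- (u * v))\<^sup>2)"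
    using assms by (intro add_mono mult_left_mono exp_le_quadratic) auto
  also have "\<dots> = 1 + u\<^sup>2 * (v * (1 - v))"
    by (simp add: algebra_simps power2_eq_square)
  also have "\<dots> \<le> exp (u\<^sup>2 * (v * (1 - v)))" by (rule exp_ge_add_one_self)
  finally show ?thesis .
qed

lemma (in real_distribution) cdf_deviation_mgf_le:
  assumes "\<bar>u\<bar> \<le> 1"
  shows "(\<integral>\<^sup>+x. ennreal (exp (u * (indicator {..y} x - cdf M y))) \<partial>M)
    \<le> ennreal (exp (u\<^sup>2 * (cdf M y * (1 - cdf M y))))"
proof -
  let ?v = "cdf M y"
  have v: "0 \<le> ?v" "?v \<le> 1" by (auto simp: cdf_nonneg cdf_bounded_prob)
  have e1: "emeasure M {..y} = ennreal ?v"
    by (simp add: cdf_def emeasure_eq_measure)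
  have e2: "emeasure M {y<..} = ennreal (1 - ?v)"
    using prob_compl[of "{..y}"] by (simp add: cdf_def emeasure_eq_measure flip: Compl_eq_Diff_UNIV)
  have "(\<integral>\<^sup>+x. ennreal (exp (u * (indicator {..y} x - ?v))) \<partial>M)
      = (\<integral>\<^sup>+x. ennreal (exp (u * (1 - ?v))) * indicator {..y} x
            + ennreal (exp (- (u * ?v))) * indicator {y<..} x \<partial>M)"
    by (intro nn_integral_cong) (auto simp: indicator_def)
  also have "\<dots> = ennreal (exp (u * (1 - ?v))) * ennreal ?v + ennreal (exp (- (u * ?v))) * ennreal (1 - ?v)"
    by (subst nn_integral_add) (simp_all add: nn_integral_cmult_indicator e1 e2)
  also have "\<dots> = ennreal (?v * exp (u * (1 - ?v)) + (1 - ?v) * exp (- (u * ?v)))"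
    using v by (simp add: mult.commute flip: ennreal_mult ennreal_plus)
  also have "\<dots> \<le> ennreal (exp (u\<^sup>2 * (?v * (1 - ?v))))"
    using assms v by (intro ennreal_leI bernoulli_mgf_le) auto
  finally show ?thesis .
qed

text \<open>The sum centres each indicator, so it equals \<open>n\<close> times the difference at
  \<open>y\<close> between the empirical distribution function of \<open>x 1, \<dots>, x n\<close>
  and \<open>G\<close>. Averaging over \<open>y\<close> instead of taking a supremum allows
  expectations to be computed for one \<open>y\<close> at a time.\<close>

definition exp_dev ::
    "real measure \<Rightarrow> (real \<Rightarrow> real) \<Rightarrow> nat \<Rightarrow> (nat \<Rightarrow> real) \<Rightarrow> (real \<Rightarrow> real) \<Rightarrow> ennreal" where
  "exp_dev \<nu> s n x G =
     (\<integral>\<^sup>+y. ennreal (exp (s y * \<bar>\<Sum>i=1..n. indicator {..y} (x i) - G y\<bar>)) \<partial>\<nu>)"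

text \<open>Jensen's inequality for \<open>exp\<close> under the probability measure
  \<open>\<nu>\<close>. The bounds on \<open>s\<close> and \<open>G\<close> keep the exponent
  between 0 and \<open>n\<close>, which supplies the integrability.\<close>

lemma exp_dev_le_expD:
  assumes "prob_space \<nu>" "sets \<nu> = sets borel"
    and [measurable]: "s \<in> borel_measurable borel" "G \<in> borel_measurable borel"
    and s: "\<And>y. 0 \<le> s y" "\<And>y. s y \<le> 1" and G: "\<And>y. 0 \<le> G y" "\<And>y. G y \<le> 1"
    and le: "exp_dev \<nu> s n x G \<le> ennreal (exp c)"
  shows "(\<integral>\<^sup>+y. ennreal (s y * \<bar>\<Sum>i=1..n. indicator {..y} (x i) - G y\<bar>) \<partial>\<nu>) \<le> ennreal c"
proof -
  interpret prob_space \<nu> by fact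
  note [measurable_cong] = assms(2)
  let ?d = "\<lambda>y. s y * \<bar>\<Sum>i=1..n. indicator {..y} (x i) - G y\<bar>"
  have "?d \<in> borel_measurable borel"
    unfolding indicator_def atMost_iff by measurable
  then have [measurable]: "?d \<in> borel_measurable \<nu>"
    by (simp add: measurable_cong_sets[OF assms(2) refl])
  have d0: "0 \<le> ?d y" for y using s by simp
  have dn: "?d y \<le> n" for y
  proof -
    have "\<bar>\<Sum>i=1..n. indicator {..y} (x i) - G y\<bar> \<le> (\<Sum>i=1..n. \<bar>indicator {..y} (x i) - G y\<bar>)"
      by (rule sum_abs)
    also have "\<dots> \<le> (\<Sum>i=1..n. 1)"
      using G[of y] by (intro sum_mono) (auto simp: indicator_def abs_le_iff add_increasing)
    finally show ?thesis
      using mult_mono[OF s(2)[of y], of "\<bar>\<Sum>i=1..n. indicator {..y} (x i) - G y\<bar>" n] by simp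
  qed
  have int: "integrable \<nu> ?d"
    by (rule integrable_const_bound[of _ "real n"]) (use d0 dn in \<open>auto simp del: One_nat_def\<close>)
  have int': "integrable \<nu> (\<lambda>y. exp (?d y))"
    by (rule integrable_const_bound[of _ "exp (real n)"]) (use dn in \<open>auto simp del: One_nat_def\<close>)
  have "convex_on UNIV (exp :: real \<Rightarrow> real)"
    by (rule f''_ge0_imp_convex[of _ exp exp exp]) (auto intro!: derivative_eq_intros)
  then have "exp (expectation ?d) \<le> expectation (\<lambda>y. exp (?d y))"
    by (intro jensens_inequality[of ?d UNIV]) (use int int' in \<open>auto simp del: One_nat_def\<close>)
  also have "\<dots> \<le> exp c"
    using le int' by (simp add: exp_dev_def nn_integral_eq_integral del: One_nat_def)
  finally have "expectation ?d \<le> c" by simp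
  then show ?thesis
    using int d0 by (simp add: nn_integral_eq_integral ennreal_leI del: One_nat_def)
qed

text \<open>Triangle inequality through the empirical distribution function of a common sample
  \<open>x\<close>, with Jensen's inequality applied to each of the two deviations.\<close>

lemma cdf_distance_le_exp_dev:
  assumes "prob_space \<nu>" "sets \<nu> = sets borel"
    and [measurable]: "s \<in> borel_measurable borel" "G \<in> borel_measurable borel" "H \<in> borel_measurable borel"
    and s: "\<And>y. 0 \<le> s y" "\<And>y. s y \<le> 1"
    and G: "\<And>y. 0 \<le> G y" "\<And>y. G y \<le> 1" and H: "\<And>y. 0 \<le> H y" "\<And>y. H y \<le> 1"
    and "exp_dev \<nu> s n x G \<le> ennreal (exp c)" "exp_dev \<nu> s n x H \<le> ennreal (exp c)"
  shows "ennreal (real n) * (\<integral>\<^sup>+y. ennreal (s y * \<bar>G y - H y\<bar>) \<partial>\<nu>) \<le> ennreal (2 * c)"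
proof -
  note [measurable_cong] = assms(2)
  let ?d = "\<lambda>G y. s y * \<bar>\<Sum>i=1..n. indicator {..y} (x i) - G y\<bar>"
  have "?d G \<in> borel_measurable borel" "?d H \<in> borel_measurable borel"
    unfolding indicator_def atMost_iff by measurable
  then have [measurable]: "?d G \<in> borel_measurable \<nu>" "?d H \<in> borel_measurable \<nu>"
    by (simp_all add: measurable_cong_sets[OF assms(2) refl])
  have G': "(\<integral>\<^sup>+y. ennreal (?d G y) \<partial>\<nu>) \<le> ennreal c" and H': "(\<integral>\<^sup>+y. ennreal (?d H y) \<partial>\<nu>) \<le> ennreal c"
    using assms by (auto intro!: exp_dev_le_expD simp del: One_nat_def)
  have "ennreal (real n) * (\<integral>\<^sup>+y. ennreal (s y * \<bar>G y - H y\<bar>) \<partial>\<nu>)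
      = (\<integral>\<^sup>+y. ennreal (real n) * ennreal (s y * \<bar>G y - H y\<bar>) \<partial>\<nu>)"
    by (rule nn_integral_cmult[symmetric]) measurable
  also have "\<dots> \<le> (\<integral>\<^sup>+y. ennreal (?d G y) + ennreal (?d H y) \<partial>\<nu>)"
  proof (rule nn_integral_mono)
    fix y
    have "real n * \<bar>G y - H y\<bar> = \<bar>real n * G y - real n * H y\<bar>"
      by (simp add: abs_mult flip: right_diff_distrib)
    also have "\<dots> \<le> \<bar>\<Sum>i=1..n. indicator {..y} (x i) - G y\<bar> + \<bar>\<Sum>i=1..n. indicator {..y} (x i) - H y\<bar>"
      by (simp add: sum_subtractf)
    finally have "s y * (real n * \<bar>G y - H y\<bar>) \<le> s y * (\<bar>\<Sum>i=1..n. indicator {..y} (x i) - G y\<bar> + \<bar>\<Sum>i=1..n. indicator {..y} (x i) - H y\<bar>)"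
      using s by (intro mult_left_mono)
    then show "ennreal (real n) * ennreal (s y * \<bar>G y - H y\<bar>) \<le> ennreal (?d G y) + ennreal (?d H y)"
      using s by (simp add: algebra_simps ennreal_leI flip: ennreal_mult ennreal_plus)
  qed
  also have "\<dots> = (\<integral>\<^sup>+y. ennreal (?d G y) \<partial>\<nu>) + (\<integral>\<^sup>+y. ennreal (?d H y) \<partial>\<nu>)"
    by (rule nn_integral_add) measurable
  also have "\<dots> \<le> ennreal c + ennreal c"
    using G' H' by (rule add_mono)
  \<comment> \<open>For negative \<open>c\<close> both sides are 0, because \<open>ennreal\<close>
    truncates.\<close>
  also have "\<dots> \<le> ennreal (2 * c)"
    by (cases "c \<ge> 0") (auto simp: ennreal_neg simp flip: ennreal_plus)
  finally show ?thesis .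
qed

text \<open>Used with \<open>f = q / p0\<close>, and with \<open>f = 1\<close> for \<open>Q = P\<close>. Only an inequality holds in the former case,
  as \<open>p0\<close> may vanish where \<open>q\<close> does not.\<close>
lemma (in prob_space) nn_integral_likelihood_exp_dev_le:
  fixes X :: "nat \<Rightarrow> 'a \<Rightarrow> real" and Q :: "real measure"
  assumes ind: "indep_vars (\<lambda>_. borel) X {1..n}"
    and X: "\<And>i. i \<in> {1..n} \<Longrightarrow> distr M borel (X i) = P"
    and Q: "real_distribution Q"
    and f[measurable]: "f \<in> borel_measurable borel"
    and fPQ: "\<And>g. g \<in> borel_measurable borel \<Longrightarrow> (\<integral>\<^sup>+x. f x * g x \<partial>P) \<le> (\<integral>\<^sup>+x. g x \<partial>Q)"
    and \<nu>: "prob_space \<nu>" "sets \<nu> = sets borel"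
    and s_meas[measurable]: "s \<in> borel_measurable borel"
    and s: "\<And>y. 0 \<le> s y" "\<And>y. s y \<le> 1"
    and c: "\<And>y. (s y)\<^sup>2 * (cdf Q y * (1 - cdf Q y)) \<le> c"
  shows "(\<integral>\<^sup>+\<omega>. (\<Prod>i=1..n. f (X i \<omega>)) * exp_dev \<nu> s n (\<lambda>i. X i \<omega>) (cdf Q) \<partial>M)
    \<le> 2 * ennreal (exp (real n * c))"
proof -
  interpret Q: real_distribution Q by fact
  interpret \<nu>: prob_space \<nu> by fact
  interpret pair_sigma_finite \<nu> M ..
  note [measurable_cong] = \<nu>(2)
  have [measurable]: "X i \<in> borel_measurable M" if "i \<in> {1..n}" for i
    using ind that by (auto simp: indep_vars_def)
  \<comment> \<open>For fixed \<open>y\<close> the tilted likelihood is a product over the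
    observations, so by independence its expectation is a product of one-dimensional integrals. The
    sign of \<open>u\<close> selects upward or downward deviations.\<close>
  let ?E = "\<lambda>u y \<omega>. \<Prod>i=1..n. f (X i \<omega>) * ennreal (exp (u * (indicator {..y} (X i \<omega>) - cdf Q y)))"
  have E: "(\<integral>\<^sup>+\<omega>. ?E u y \<omega> \<partial>M) \<le> ennreal (exp (real n * c))"
    if u: "u = s y \<or> u = - s y" for u y
  proof -
    let ?g = "\<lambda>x. f x * ennreal (exp (u * (indicator {..y} x - cdf Q y)))"
    have g[measurable]: "?g \<in> borel_measurable borel"
      unfolding indicator_def atMost_iff by measurable
    have "indep_vars (\<lambda>_. borel) (\<lambda>i. ?g \<circ> X i) {1..n}"
      by (rule indep_vars_compose[OF ind]) simp
    then have "(\<integral>\<^sup>+\<omega>. ?E u y \<omega> \<partial>M) = (\<Prod>i=1..n. \<integral>\<^sup>+\<omega>. ?g (X i \<omega>) \<partial>M)"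
      by (subst indep_vars_nn_integral[symmetric]) (auto simp: comp_def)
    also have "\<dots> \<le> (\<Prod>i=1..n. ennreal (exp c))"
    proof (rule prod_mono_ennreal)
      fix i assume i: "i \<in> {1..n}"
      have "(\<integral>\<^sup>+\<omega>. ?g (X i \<omega>) \<partial>M) = (\<integral>\<^sup>+x. ?g x \<partial>P)"
        using i g by (simp flip: X[OF i] add: nn_integral_distr)
      also have "\<dots> \<le> (\<integral>\<^sup>+x. ennreal (exp (u * (indicator {..y} x - cdf Q y))) \<partial>Q)"
        by (rule fPQ) (unfold indicator_def atMost_iff, measurable)
      also have "\<dots> \<le> ennreal (exp (u\<^sup>2 * (cdf Q y * (1 - cdf Q y))))"
        using u s[of y] by (intro Q.cdf_deviation_mgf_le) auto
      also have "\<dots> \<le> ennreal (exp c)"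
        using u c[of y] by (intro ennreal_leI) auto
      finally show "(\<integral>\<^sup>+\<omega>. ?g (X i \<omega>) \<partial>M) \<le> ennreal (exp c)" .
    qed
    also have "\<dots> = ennreal (exp (real n * c))"
      by (simp add: ennreal_power exp_of_nat_mult)
    finally show ?thesis .
  qed
  have mE[measurable]: "(\<lambda>(y, \<omega>). ?E (s y) y \<omega>) \<in> borel_measurable (\<nu> \<Otimes>\<^sub>M M)"
    "(\<lambda>(y, \<omega>). ?E (- s y) y \<omega>) \<in> borel_measurable (\<nu> \<Otimes>\<^sub>M M)"
    unfolding indicator_def atMost_iff by measurable
  have mS: "(\<lambda>(y, \<omega>). ?E (s y) y \<omega> + ?E (- s y) y \<omega>) \<in> borel_measurable (\<nu> \<Otimes>\<^sub>M M)"
    unfolding indicator_def atMost_iff by measurable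
  have "(\<integral>\<^sup>+\<omega>. (\<Prod>i=1..n. f (X i \<omega>)) * exp_dev \<nu> s n (\<lambda>i. X i \<omega>) (cdf Q) \<partial>M)
      \<le> (\<integral>\<^sup>+\<omega>. (\<integral>\<^sup>+y. ?E (s y) y \<omega> + ?E (- s y) y \<omega> \<partial>\<nu>) \<partial>M)"
  proof (rule nn_integral_mono)
    fix \<omega> assume "\<omega> \<in> space M"
    let ?Y = "\<lambda>y. \<Sum>i=1..n. indicator {..y} (X i \<omega>) - cdf Q y"
    have "(\<Prod>i=1..n. f (X i \<omega>)) * exp_dev \<nu> s n (\<lambda>i. X i \<omega>) (cdf Q) =
        (\<integral>\<^sup>+y. (\<Prod>i=1..n. f (X i \<omega>)) * ennreal (exp (s y * \<bar>?Y y\<bar>)) \<partial>\<nu>)"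
      unfolding exp_dev_def indicator_def atMost_iff by (rule nn_integral_cmult[symmetric]) measurable
    also have "\<dots> \<le> (\<integral>\<^sup>+y. ?E (s y) y \<omega> + ?E (- s y) y \<omega> \<partial>\<nu>)"
    proof (rule nn_integral_mono)
      fix y
      have eq: "?E u y \<omega> = (\<Prod>i=1..n. f (X i \<omega>)) * ennreal (exp (u * ?Y y))" for u
        by (simp add: prod.distrib prod_ennreal exp_sum sum_distrib_left)
      \<comment> \<open>The modulus is removed by adding the two signs; this is the source of the
        factor 2.\<close>
      have "exp (s y * \<bar>?Y y\<bar>) \<le> exp (s y * ?Y y) + exp (- s y * ?Y y)"
        by (cases "?Y y \<ge> 0") (auto simp: abs_if)
      then show "(\<Prod>i=1..n. f (X i \<omega>)) * ennreal (exp (s y * \<bar>?Y y\<bar>)) \<le> ?E (s y) y \<omega> + ?E (- s y) y \<omega>"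
        unfolding eq by (simp flip: distrib_left ennreal_plus add: mult_left_mono ennreal_leI)
    qed
    finally show "(\<Prod>i=1..n. f (X i \<omega>)) * exp_dev \<nu> s n (\<lambda>i. X i \<omega>) (cdf Q) \<le> \<dots>" .
  qed
  \<comment> \<open>With the expectation taken first, the bound for each single \<open>y\<close>
    suffices.\<close>
  also have "\<dots> = (\<integral>\<^sup>+y. (\<integral>\<^sup>+\<omega>. ?E (s y) y \<omega> + ?E (- s y) y \<omega> \<partial>M) \<partial>\<nu>)"
    by (rule Fubini'[OF mS])
  also have "\<dots> \<le> (\<integral>\<^sup>+y. 2 * ennreal (exp (real n * c)) \<partial>\<nu>)"
  proof (rule nn_integral_mono)
    fix y
    have "(\<integral>\<^sup>+\<omega>. ?E (s y) y \<omega> + ?E (- s y) y \<omega> \<partial>M) = (\<integral>\<^sup>+\<omega>. ?E (s y) y \<omega> \<partial>M) + (\<integral>\<^sup>+\<omega>. ?E (- s y) y \<omega> \<partial>M)"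
      unfolding indicator_def atMost_iff by (rule nn_integral_add) measurable
    also have "\<dots> \<le> 2 * ennreal (exp (real n * c))"
      unfolding mult_2 by (intro add_mono E) auto
    finally show "(\<integral>\<^sup>+\<omega>. ?E (s y) y \<omega> + ?E (- s y) y \<omega> \<partial>M) \<le> \<dots>" .
  qed
  also have "\<dots> = 2 * ennreal (exp (real n * c))"
    by (simp add: \<nu>.emeasure_space_1)
  finally show ?thesis .
qed

section \<open>Moments and weighted distances of distribution functions\<close>

text \<open>Markov's inequality in the form needed for the shifted weight: if \<open>y\<close> has
  modulus at least that of \<open>x\<close>, then \<open>1 + \<bar>x\<bar>\<close> is at most twice
  the maximum of 1 and \<open>\<bar>y\<bar>\<close>. This stays meaningful at
  \<open>x = 0\<close>.\<close>

lemma (in real_distribution) moment_tail_le: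
  assumes "abs_moment r M \<le> ennreal K" "r \<ge> 0" "K \<ge> 0"
  shows "(1 + \<bar>x\<bar>) powr r * prob {y. \<bar>x\<bar> \<le> \<bar>y\<bar>} \<le> 2 powr r * (1 + K)"
proof -
  have "ennreal ((1 + \<bar>x\<bar>) powr r * prob {y. \<bar>x\<bar> \<le> \<bar>y\<bar>})
      = (\<integral>\<^sup>+y\<in>{y. \<bar>x\<bar> \<le> \<bar>y\<bar>}. ennreal ((1 + \<bar>x\<bar>) powr r) \<partial>M)"
    by (simp add: nn_integral_cmult_indicator emeasure_eq_measure ennreal_mult)
  also have "\<dots> \<le> (\<integral>\<^sup>+y. ennreal (2 powr r) * (1 + ennreal (\<bar>y\<bar> powr r)) \<partial>M)"
  proof (rule nn_integral_mono)
    fix y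
    have "(1 + \<bar>x\<bar>) powr r \<le> 2 powr r * (1 + \<bar>y\<bar> powr r)" if "\<bar>x\<bar> \<le> \<bar>y\<bar>"
    proof -
      have "(1 + \<bar>x\<bar>) powr r \<le> (2 * max 1 \<bar>y\<bar>) powr r"
        using that assms by (intro powr_mono2) auto
      also have "\<dots> = 2 powr r * (max 1 \<bar>y\<bar>) powr r"
        by (simp add: powr_mult)
      also have "\<dots> \<le> 2 powr r * (1 + \<bar>y\<bar> powr r)"
        by (intro mult_left_mono) (auto simp: max_def)
      finally show ?thesis .
    qed
    then show "ennreal ((1 + \<bar>x\<bar>) powr r) * indicator {y. \<bar>x\<bar> \<le> \<bar>y\<bar>} y
        \<le> ennreal (2 powr r) * (1 + ennreal (\<bar>y\<bar> powr r))"
      by (auto simp: indicator_def ennreal_leI simp flip: ennreal_mult ennreal_plus ennreal_1)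
  qed
  also have "\<dots> = ennreal (2 powr r) * (1 + abs_moment r M)"
    using emeasure_space_1 by (simp add: nn_integral_cmult nn_integral_add abs_moment_def)
  also have "\<dots> \<le> ennreal (2 powr r) * (1 + ennreal K)"
    using assms by (intro mult_left_mono add_left_mono) auto
  also have "\<dots> = ennreal (2 powr r * (1 + K))"
    using assms by (simp add: ennreal_mult)
  finally show ?thesis using assms by simp
qed

text \<open>The half-line cut off at \<open>x\<close> on the side away from the origin lies in the
  symmetric tail set. Which side it is depends only on the sign of \<open>x\<close>, so the case is
  the same for any two distributions.\<close>

lemma (in real_distribution) cdf_tail_cases:
  "(x < 0 \<and> cdf M x \<le> prob {y. \<bar>x\<bar> \<le> \<bar>y\<bar>}) \<or> (x \<ge> 0 \<and> 1 - cdf M x \<le> prob {y. \<bar>x\<bar> \<le> \<bar>y\<bar>})"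
proof (cases "x < 0")
  case True
  then have "cdf M x \<le> prob {y. \<bar>x\<bar> \<le> \<bar>y\<bar>}"
    unfolding cdf_def by (intro finite_measure_mono) auto
  then show ?thesis using True by simp
next
  case False
  have "1 - cdf M x = prob {x<..}"
    using prob_compl[of "{..x}"] by (simp add: cdf_def flip: Compl_eq_Diff_UNIV)
  also have "\<dots> \<le> prob {y. \<bar>x\<bar> \<le> \<bar>y\<bar>}"
    using False by (intro finite_measure_mono) auto
  finally show ?thesis using False by simp
qed

lemma (in real_distribution) cdf_variance_le:
  assumes "abs_moment r M \<le> ennreal K" "r \<ge> 0" "K \<ge> 0"
  shows "(1 + \<bar>x\<bar>) powr r * (cdf M x * (1 - cdf M x)) \<le> 2 powr r * (1 + K)"
proof -
  let ?T = "prob {y. \<bar>x\<bar> \<le> \<bar>y\<bar>}"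
  have F: "0 \<le> cdf M x" "cdf M x \<le> 1" by (auto simp: cdf_nonneg cdf_bounded_prob)
  have "cdf M x * (1 - cdf M x) \<le> ?T"
    using cdf_tail_cases[of x]
  proof
    assume "x < 0 \<and> cdf M x \<le> ?T"
    then show ?thesis using mult_right_le_one_le[of "cdf M x" "1 - cdf M x"] F by linarith
  next
    assume "x \<ge> 0 \<and> 1 - cdf M x \<le> ?T"
    then show ?thesis using mult_left_le_one_le[of "1 - cdf M x" "cdf M x"] F by linarith
  qed
  then have "(1 + \<bar>x\<bar>) powr r * (cdf M x * (1 - cdf M x)) \<le> (1 + \<bar>x\<bar>) powr r * ?T"
    by (rule mult_left_mono) simp
  also have "\<dots> \<le> 2 powr r * (1 + K)" by (rule moment_tail_le[OF assms])
  finally show ?thesis .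
qed

text \<open>Depending on the sign of \<open>x\<close>, either both distribution functions are at
  most their tail masses or both complements are, so the difference is at most the sum of the two
  tails.\<close>

lemma cdf_diff_tail_le:
  assumes "real_distribution P" "real_distribution Q"
    and "abs_moment r P \<le> ennreal K" "abs_moment r Q \<le> ennreal K" "r \<ge> 0" "K \<ge> 0"
  shows "(1 + \<bar>x\<bar>) powr r * \<bar>cdf P x - cdf Q x\<bar> \<le> 2 * (2 powr r * (1 + K))"
proof -
  interpret P: real_distribution P by fact
  interpret Q: real_distribution Q by fact
  have "\<bar>cdf P x - cdf Q x\<bar> \<le> P.prob {y. \<bar>x\<bar> \<le> \<bar>y\<bar>} + Q.prob {y. \<bar>x\<bar> \<le> \<bar>y\<bar>}"
    using P.cdf_tail_cases[of x] Q.cdf_tail_cases[of x]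
      P.cdf_nonneg[of x] Q.cdf_nonneg[of x] P.cdf_bounded_prob[of x] Q.cdf_bounded_prob[of x]
    by linarith
  then have "(1 + \<bar>x\<bar>) powr r * \<bar>cdf P x - cdf Q x\<bar>
      \<le> (1 + \<bar>x\<bar>) powr r * (P.prob {y. \<bar>x\<bar> \<le> \<bar>y\<bar>} + Q.prob {y. \<bar>x\<bar> \<le> \<bar>y\<bar>})"
    by (intro mult_left_mono) auto
  then show ?thesis
    using P.moment_tail_le[of r K x] Q.moment_tail_le[of r K x] assms by (simp add: distrib_left)
qed

text \<open>A symmetric Pareto law shifted to have full support, with tail index \<open>a\<close>
  and normalising factor \<open>a / 2\<close>. It is the averaging measure for the thresholds in
  \<open>exp_dev\<close>.\<close>

definition pareto :: "real \<Rightarrow> real measure" where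
  "pareto a = density lborel (\<lambda>x. ennreal (a / 2 * (1 + \<bar>x\<bar>) powr (- a - 1)))"

lemma sets_pareto [simp, measurable_cong]: "sets (pareto a) = sets borel"
  by (simp add: pareto_def)

lemma prob_space_pareto:
  assumes "a > 0"
  shows "prob_space (pareto a)"
proof
  let ?h = "\<lambda>x::real. a / 2 * (1 + \<bar>x\<bar>) powr (- a - 1)"
  have "((\<lambda>x::real. - ((1 + x) powr (- a) / 2)) \<longlongrightarrow> - (0 / 2)) at_top"
    using assms
    by (intro tendsto_intros tendsto_neg_powr filterlim_tendsto_add_at_top[OF tendsto_const] filterlim_ident) auto
  then have "(\<integral>\<^sup>+x. ennreal (?h x) * indicator {0..} x \<partial>lborel) = ennreal (0 - - ((1 + 0) powr (- a) / 2))"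
    using assms
    by (intro nn_integral_FTC_atLeast) (auto intro!: derivative_eq_intros simp: field_simps)
  then have half: "(\<integral>\<^sup>+x. ennreal (?h x) * indicator {0..} x \<partial>lborel) = ennreal (1 / 2)"
    by simp
  \<comment> \<open>The negative half-line has the same mass by reflection; the two halves overlap
    only in the null set consisting of 0.\<close>
  also have "(\<integral>\<^sup>+x. ennreal (?h x) * indicator {0..} x \<partial>lborel) =
      (\<integral>\<^sup>+x. ennreal (?h x) * indicator {..0} x \<partial>lborel)"
    by (subst nn_integral_real_affine[of _ "- 1" 0])
      (auto simp: indicator_def intro!: nn_integral_cong)
  finally have half': "(\<integral>\<^sup>+x. ennreal (?h x) * indicator {..0} x \<partial>lborel) = ennreal (1 / 2)" .
  have "emeasure (pareto a) (space (pareto a)) = (\<integral>\<^sup>+x. ennreal (?h x) \<partial>lborel)"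
    by (simp add: pareto_def emeasure_density)
  also have "\<dots> = (\<integral>\<^sup>+x. ennreal (?h x) * indicator {0..} x + ennreal (?h x) * indicator {..0} x \<partial>lborel)"
    by (intro nn_integral_cong_AE eventually_mono[OF AE_lborel_singleton[of 0]]) (auto simp: indicator_def)
  also have "\<dots> = (\<integral>\<^sup>+x. ennreal (?h x) * indicator {0..} x \<partial>lborel) + (\<integral>\<^sup>+x. ennreal (?h x) * indicator {..0} x \<partial>lborel)"
    by (intro nn_integral_add) auto
  also have "\<dots> = 1"
    unfolding half half' by (subst ennreal_plus[symmetric]) auto
  finally show "emeasure (pareto a) (space (pareto a)) = 1" .
qed

text \<open>The Lebesgue integral becomes an integral against a probability measure, so that
  Jensen's inequality applies. The price is the exponent \<open>p + a\<close> in place of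
  \<open>p - 1\<close> and the inverse \<open>2 / a\<close> of the normalising factor.\<close>

lemma ennreal_rpow_wasserstein_le_pareto:
  assumes "real_distribution P" "real_distribution Q" "p \<ge> 1" "a > 0"
  shows "ennreal_rpow (wasserstein p P Q) p \<le>
    ennreal (4 powr p * (2 / a)) * (\<integral>\<^sup>+x. ennreal ((1 + \<bar>x\<bar>) powr (p + a) * \<bar>cdf P x - cdf Q x\<bar>) \<partial>pareto a)"
proof -
  interpret P: real_distribution P by fact
  interpret Q: real_distribution Q by fact
  have const: "ennreal (4 powr p * (2 / a)) = ennreal (4 powr p) * ennreal (2 / a)"
    using assms by (intro ennreal_mult) auto
  have "ennreal_rpow (wasserstein p P Q) p \<le>
      ennreal (4 powr p) * (\<integral>\<^sup>+x. ennreal ((1 + \<bar>x\<bar>) powr (p - 1) * \<bar>cdf P x - cdf Q x\<bar>) \<partial>lborel)"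
    by (rule ennreal_rpow_wasserstein_le_cdf[OF assms(1-3)])
  also have "(\<integral>\<^sup>+x. ennreal ((1 + \<bar>x\<bar>) powr (p - 1) * \<bar>cdf P x - cdf Q x\<bar>) \<partial>lborel)
      = (\<integral>\<^sup>+x. ennreal (2 / a) * (ennreal (a / 2 * (1 + \<bar>x\<bar>) powr (- a - 1)) *
          ennreal ((1 + \<bar>x\<bar>) powr (p + a) * \<bar>cdf P x - cdf Q x\<bar>)) \<partial>lborel)"
  proof (rule nn_integral_cong)
    fix x :: real
    have "(1 + \<bar>x\<bar>) powr (p - 1) = (1 + \<bar>x\<bar>) powr (- a - 1) * (1 + \<bar>x\<bar>) powr (p + a)"
      by (simp flip: powr_add)
    then show "ennreal ((1 + \<bar>x\<bar>) powr (p - 1) * \<bar>cdf P x - cdf Q x\<bar>) =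
        ennreal (2 / a) * (ennreal (a / 2 * (1 + \<bar>x\<bar>) powr (- a - 1)) *
          ennreal ((1 + \<bar>x\<bar>) powr (p + a) * \<bar>cdf P x - cdf Q x\<bar>))"
      using assms by (simp flip: ennreal_mult)
  qed
  also have "\<dots> = ennreal (2 / a) * (\<integral>\<^sup>+x. ennreal ((1 + \<bar>x\<bar>) powr (p + a) * \<bar>cdf P x - cdf Q x\<bar>) \<partial>pareto a)"
    unfolding pareto_def by (subst nn_integral_density) (simp_all add: nn_integral_cmult)
  finally show ?thesis
    by (simp only: const mult.assoc)
qed

text \<open>The cut at 1 keeps the argument of the moment generating function in the range where the
  quadratic bound of \<open>exp\<close> holds. Beyond the cut the weight is 0 rather than 1, as that
  region is left to the moment bounds.\<close>

definition cut_weight :: "real \<Rightarrow> real \<Rightarrow> real \<Rightarrow> real" where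
  "cut_weight r e x = (let u = e * (1 + \<bar>x\<bar>) powr r in if u \<le> 1 then u else 0)"

lemma borel_measurable_cut_weight [measurable]: "cut_weight r e \<in> borel_measurable borel"
  unfolding cut_weight_def Let_def by measurable

lemma cut_weight_bounds:
  assumes "e \<ge> 0"
  shows "0 \<le> cut_weight r e x" "cut_weight r e x \<le> 1"
  using assms by (auto simp: cut_weight_def Let_def)

text \<open>Squaring the weight produces the power \<open>2 * r\<close>, exactly what the moment of
  that order controls through the variance \<open>F(1 - F)\<close>. The resulting bound is uniform
  in \<open>x\<close> and of order \<open>e\<^sup>2\<close>.\<close>

lemma (in real_distribution) cut_weight_variance_le:
  assumes "abs_moment (2 * r) M \<le> ennreal K" "r \<ge> 0" "K \<ge> 0"
  shows "(cut_weight r e x)\<^sup>2 * (cdf M x * (1 - cdf M x)) \<le> e\<^sup>2 * (2 powr (2 * r) * (1 + K))"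
proof -
  have F: "0 \<le> cdf M x * (1 - cdf M x)" by (auto simp: cdf_nonneg cdf_bounded_prob)
  have sq: "(e * (1 + \<bar>x\<bar>) powr r)\<^sup>2 = e\<^sup>2 * (1 + \<bar>x\<bar>) powr (2 * r)"
    by (simp add: power_mult_distrib power2_eq_square flip: powr_add)
  have "(cut_weight r e x)\<^sup>2 * (cdf M x * (1 - cdf M x)) \<le>
      e\<^sup>2 * (1 + \<bar>x\<bar>) powr (2 * r) * (cdf M x * (1 - cdf M x))"
    using F by (intro mult_right_mono) (auto simp: cut_weight_def Let_def sq)
  also have "\<dots> \<le> e\<^sup>2 * (2 powr (2 * r) * (1 + K))"
    using mult_left_mono[OF cdf_variance_le[of "2 * r" K x], of "e\<^sup>2"] assms by (simp add: mult.assoc)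
  finally show ?thesis .
qed

text \<open>Where the factor \<open>e * (1 + \<bar>x\<bar>) powr r\<close> exceeds 1 it is at most
  its own square, and the square times the difference of distribution functions is of order
  \<open>e\<^sup>2\<close> by the tail bound.\<close>

lemma weighted_cdf_diff_le_cut:
  assumes "real_distribution P" "real_distribution Q"
    and "abs_moment (2 * r) P \<le> ennreal K" "abs_moment (2 * r) Q \<le> ennreal K" "r \<ge> 0" "K \<ge> 0" "e \<ge> 0"
  shows "e * ((1 + \<bar>x\<bar>) powr r * \<bar>cdf P x - cdf Q x\<bar>) \<le>
    cut_weight r e x * \<bar>cdf P x - cdf Q x\<bar> + e\<^sup>2 * (2 * (2 powr (2 * r) * (1 + K)))"
proof (cases "e * (1 + \<bar>x\<bar>) powr r \<le> 1")
  case True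
  then show ?thesis using assms by (simp add: cut_weight_def)
next
  case False
  let ?u = "e * (1 + \<bar>x\<bar>) powr r" and ?D = "\<bar>cdf P x - cdf Q x\<bar>"
  have sq: "?u * ?u = e\<^sup>2 * (1 + \<bar>x\<bar>) powr (2 * r)"
    by (simp add: power2_eq_square flip: powr_add)
  have "?u \<le> ?u * ?u" using False mult_right_mono[of 1 ?u ?u] by simp
  then have "?u * ?D \<le> ?u * ?u * ?D" by (rule mult_right_mono) simp
  also have "\<dots> = e\<^sup>2 * ((1 + \<bar>x\<bar>) powr (2 * r) * ?D)"
    unfolding sq by simp
  also have "\<dots> \<le> e\<^sup>2 * (2 * (2 powr (2 * r) * (1 + K)))"
    using assms by (intro mult_left_mono cdf_diff_tail_le) auto
  finally show ?thesis using False by (simp add: cut_weight_def mult.assoc)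
qed

text \<open>A deterministic statement about one sample. With the tail index
  \<open>\<delta> / 2\<close>, twice the exponent of the weight is the order
  \<open>2 * p + \<delta>\<close> of the moments. The two comparisons with the empirical
  distribution function give \<open>2 * B\<close>, the region beyond the cut gives the other
  summand, and one factor \<open>e\<close> is divided out. It is used contrapositively: if the
  distance is large and the sample fits \<open>Q\<close>, it cannot fit \<open>P\<close>.\<close>

lemma wasserstein_le_of_exp_dev_le:
  assumes P: "real_distribution P" and Q: "real_distribution Q"
    and mom: "abs_moment (2 * p + \<delta>) P \<le> ennreal K" "abs_moment (2 * p + \<delta>) Q \<le> ennreal K"
    and pos: "p \<ge> 1" "\<delta> > 0" "K \<ge> 0" "e > 0" "n \<ge> 1" "B \<ge> 0"
    and dev: "exp_dev (pareto (\<delta> / 2)) (cut_weight (p + \<delta> / 2) e) n x (cdf P) \<le> ennreal (exp (real n * e\<^sup>2 * B))"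
      "exp_dev (pareto (\<delta> / 2)) (cut_weight (p + \<delta> / 2) e) n x (cdf Q) \<le> ennreal (exp (real n * e\<^sup>2 * B))"
  shows "ennreal_rpow (wasserstein p P Q) p \<le>
    ennreal (4 powr p * (4 / \<delta>) * ((2 * B + 2 * (2 powr (2 * p + \<delta>) * (1 + K))) * e))"
proof -
  interpret P: real_distribution P by fact
  interpret Q: real_distribution Q by fact
  define a where "a = \<delta> / 2"
  define C where "C = 2 powr (2 * p + \<delta>) * (1 + K)"
  let ?D = "\<lambda>x. \<bar>cdf P x - cdf Q x\<bar>" and ?s = "cut_weight (p + a) e"
  have a: "a > 0" "2 * (p + a) = 2 * p + \<delta>" using pos by (auto simp: a_def)
  have C0: "C \<ge> 0" using pos by (simp add: C_def)
  interpret \<nu>: prob_space "pareto a" using a by (intro prob_space_pareto)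
  have "ennreal (real n) * (\<integral>\<^sup>+x. ennreal (?s x * ?D x) \<partial>pareto a) \<le> ennreal (2 * (real n * e\<^sup>2 * B))"
    using dev pos cut_weight_bounds[of e "p + a"]
    by (intro cdf_distance_le_exp_dev[of _ _ _ _ n x])
       (auto simp: a_def[symmetric] P.cdf_nonneg Q.cdf_nonneg P.cdf_bounded_prob Q.cdf_bounded_prob \<nu>.prob_space_axioms)
  also have "\<dots> = ennreal (real n) * ennreal (2 * B * e\<^sup>2)"
    using pos by (simp flip: ennreal_mult add: ac_simps)
  finally have cut: "(\<integral>\<^sup>+x. ennreal (?s x * ?D x) \<partial>pareto a) \<le> ennreal (2 * B * e\<^sup>2)"
    using pos by (simp add: ennreal_mult_le_mult_iff)
  have "ennreal e * (\<integral>\<^sup>+x. ennreal ((1 + \<bar>x\<bar>) powr (p + a) * ?D x) \<partial>pareto a)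
      = (\<integral>\<^sup>+x. ennreal (e * ((1 + \<bar>x\<bar>) powr (p + a) * ?D x)) \<partial>pareto a)"
    using pos by (subst nn_integral_cmult[symmetric]) (simp_all add: ennreal_mult)
  also have "\<dots> \<le> (\<integral>\<^sup>+x. ennreal (?s x * ?D x) + ennreal (2 * C * e\<^sup>2) \<partial>pareto a)"
  proof (rule nn_integral_mono)
    fix x
    have "e * ((1 + \<bar>x\<bar>) powr (p + a) * ?D x) \<le> ?s x * ?D x + e\<^sup>2 * (2 * (2 powr (2 * (p + a)) * (1 + K)))"
      using mom pos a by (intro weighted_cdf_diff_le_cut[OF P Q]) auto
    then show "ennreal (e * ((1 + \<bar>x\<bar>) powr (p + a) * ?D x)) \<le> ennreal (?s x * ?D x) + ennreal (2 * C * e\<^sup>2)"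
      using pos C0 cut_weight_bounds(1)[of e "p + a" x] a
      by (simp add: C_def ac_simps flip: ennreal_plus)
  qed
  also have "\<dots> = (\<integral>\<^sup>+x. ennreal (?s x * ?D x) \<partial>pareto a) + ennreal (2 * C * e\<^sup>2)"
    by (subst nn_integral_add) (simp_all add: \<nu>.emeasure_space_1)
  also have "\<dots> \<le> ennreal (2 * B * e\<^sup>2) + ennreal (2 * C * e\<^sup>2)"
    using cut by (rule add_right_mono)
  also have "\<dots> = ennreal e * ennreal ((2 * B + 2 * C) * e)"
    using pos C0 by (simp flip: ennreal_mult ennreal_plus add: algebra_simps power2_eq_square)
  finally have main: "(\<integral>\<^sup>+x. ennreal ((1 + \<bar>x\<bar>) powr (p + a) * ?D x) \<partial>pareto a) \<le> ennreal ((2 * B + 2 * C) * e)"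
    using pos by (simp add: ennreal_mult_le_mult_iff)
  have "ennreal_rpow (wasserstein p P Q) p \<le>
      ennreal (4 powr p * (2 / a)) * (\<integral>\<^sup>+x. ennreal ((1 + \<bar>x\<bar>) powr (p + a) * ?D x) \<partial>pareto a)"
    using pos a by (intro ennreal_rpow_wasserstein_le_pareto P Q) auto
  also have "\<dots> \<le> ennreal (4 powr p * (2 / a)) * ennreal ((2 * B + 2 * C) * e)"
    using main by (rule mult_left_mono) simp
  also have "\<dots> = ennreal (4 powr p * (4 / \<delta>) * ((2 * B + 2 * C) * e))"
    using pos C0 by (simp flip: ennreal_mult add: a_def)
  finally show ?thesis by (simp add: C_def)
qed

section \<open>Lower bound for the evidence\<close>

lemma sets_law [simp, measurable_cong]: "sets (law q) = sets borel"
  by (simp add: law_def)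

lemma real_distribution_law:
  assumes "prob_density q"
  shows "real_distribution (law q)"
proof -
  have "prob_space (law q)"
    using assms by (intro prob_spaceI) (simp add: law_def emeasure_density prob_density_def)
  then show ?thesis
    by (simp add: real_distribution_def real_distribution_axioms_def)
qed

text \<open>The new variable is independent of the sum of the earlier ones and centred, so the cross
  term has expectation 0. Integrability is carried through the induction because Bochner
  expectations are split.\<close>

lemma (in prob_space) indep_vars_centered_sum_square:
  fixes Y :: "'i \<Rightarrow> 'a \<Rightarrow> real"
  assumes "finite I" "indep_vars (\<lambda>_. borel) Y I"
    and "\<And>i. i \<in> I \<Longrightarrow> integrable M (\<lambda>\<omega>. (Y i \<omega>)\<^sup>2)" "\<And>i. i \<in> I \<Longrightarrow> expectation (Y i) = 0"
  shows "integrable M (\<lambda>\<omega>. (\<Sum>i\<in>I. Y i \<omega>)\<^sup>2) \<and>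
    expectation (\<lambda>\<omega>. (\<Sum>i\<in>I. Y i \<omega>)\<^sup>2) = (\<Sum>i\<in>I. expectation (\<lambda>\<omega>. (Y i \<omega>)\<^sup>2))"
  using assms
proof (induction I rule: finite_induct)
  case (insert j I)
  let ?S = "\<lambda>\<omega>. \<Sum>i\<in>I. Y i \<omega>"
  have IH: "integrable M (\<lambda>\<omega>. (?S \<omega>)\<^sup>2)"
    "expectation (\<lambda>\<omega>. (?S \<omega>)\<^sup>2) = (\<Sum>i\<in>I. expectation (\<lambda>\<omega>. (Y i \<omega>)\<^sup>2))"
    using insert by (auto intro: indep_vars_subset)
  have rv: "random_variable borel (Y i)" if "i \<in> insert j I" for i
    using insert.prems(1) that by (auto simp: indep_vars_def)
  have int: "integrable M (Y i)" if "i \<in> insert j I" for i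
    using rv[OF that] insert.prems(2)[OF that] by (rule square_integrable_imp_integrable)
  have iS: "integrable M ?S" using int by auto
  have ind: "indep_var borel (Y j) borel ?S"
    using insert by (intro indep_vars_sum) auto
  have m: "integrable M (\<lambda>\<omega>. Y j \<omega> * ?S \<omega>)" "expectation (\<lambda>\<omega>. Y j \<omega> * ?S \<omega>) = 0"
    using indep_var_integrable[OF ind int iS] indep_var_lebesgue_integral[OF ind int iS] insert.prems(3)
    by auto
  have eq: "(\<Sum>i\<in>insert j I. Y i \<omega>)\<^sup>2 = (Y j \<omega>)\<^sup>2 + 2 * (Y j \<omega> * ?S \<omega>) + (?S \<omega>)\<^sup>2" for \<omega>
    using insert.hyps by (simp add: power2_sum)
  have ij: "integrable M (\<lambda>\<omega>. (Y j \<omega>)\<^sup>2)" using insert.prems(2) by simp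
  show ?case
    unfolding eq using IH m ij insert.hyps by simp
qed simp

lemma ext_integral_nonneg:
  assumes "\<And>x. f x \<ge> 0"
  shows "ext_integral M f = enn2ereal (\<integral>\<^sup>+x. e2ennreal (f x) \<partial>M)"
  using assms by (simp add: ext_integral_def e2ennreal_neg zero_ennreal.rep_eq)

text \<open>Replaces the extended integrals by Bochner integrals. The square of
  \<open>log_ratio\<close> is infinite at zeros of \<open>q\<close>, so a finite second moment makes
  these a null set. It also makes \<open>L\<close> square integrable, hence integrable under a
  probability measure.\<close>

lemma KL_nbhd_log_ratio:
  assumes q: "q \<in> KL_nbhd F p0 e" and [measurable]: "q \<in> borel_measurable borel"
    and p0: "prob_density p0"
  defines "L \<equiv> (\<lambda>x. ln (p0 x / q x))"
  shows "AE x in law p0. q x \<noteq> 0" "integrable (law p0) L" "integrable (law p0) (\<lambda>x. (L x)\<^sup>2)"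
    "(\<integral>x. L x \<partial>law p0) \<le> e\<^sup>2" "(\<integral>x. (L x)\<^sup>2 \<partial>law p0) \<le> e\<^sup>2"
proof -
  have [measurable]: "p0 \<in> borel_measurable borel" using p0 by (simp add: prob_density_def)
  interpret real_distribution "law p0" using p0 by (rule real_distribution_law)
  have [measurable]: "L \<in> borel_measurable borel" unfolding L_def by measurable
  let ?N = "\<integral>\<^sup>+x. (if q x = 0 then \<infinity> else ennreal ((L x)\<^sup>2)) \<partial>law p0"
  have "e2ennreal ((log_ratio (p0 x) (q x))\<^sup>2) = (if q x = 0 then \<infinity> else ennreal ((L x)\<^sup>2))" for x
    by (simp add: log_ratio_def L_def power2_eq_square)
  moreover have "ext_integral (law p0) (\<lambda>x. (log_ratio (p0 x) (q x))\<^sup>2) \<le> ereal (e\<^sup>2)"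
    using q by (simp add: KL_nbhd_def)
  moreover have "(log_ratio (p0 x) (q x))\<^sup>2 \<ge> 0" for x
    by (simp add: log_ratio_def power2_eq_square)
  ultimately have "enn2ereal ?N \<le> ereal (e\<^sup>2)"
    by (simp add: ext_integral_nonneg)
  then have "e2ennreal (enn2ereal ?N) \<le> e2ennreal (ereal (e\<^sup>2))" by (rule e2ennreal_mono)
  then have N: "?N \<le> ennreal (e\<^sup>2)" by simp
  then have "?N \<noteq> \<infinity>" by (auto simp: top_unique)
  then have "AE x in law p0. (if q x = 0 then \<infinity> else ennreal ((L x)\<^sup>2)) \<noteq> \<infinity>"
    by (intro nn_integral_PInf_AE) auto
  then show ae: "AE x in law p0. q x \<noteq> 0" by eventually_elim (auto split: if_splits)
  have "(\<integral>\<^sup>+x. ennreal ((L x)\<^sup>2) \<partial>law p0) = ?N"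
    using ae by (intro nn_integral_cong_AE) auto
  then have N2: "(\<integral>\<^sup>+x. ennreal ((L x)\<^sup>2) \<partial>law p0) \<le> ennreal (e\<^sup>2)" using N by simp
  show int2: "integrable (law p0) (\<lambda>x. (L x)\<^sup>2)"
    by (rule integrableI_nonneg) (use N2 in \<open>auto simp: less_top[symmetric] top_unique\<close>)
  then show "(\<integral>x. (L x)\<^sup>2 \<partial>law p0) \<le> e\<^sup>2"
    using N2 by (simp add: nn_integral_eq_integral)
  show int: "integrable (law p0) L"
    by (rule square_integrable_imp_integrable) (use int2 in auto)
  have pos: "(\<integral>\<^sup>+x. e2ennreal (log_ratio (p0 x) (q x)) \<partial>law p0) = (\<integral>\<^sup>+x. ennreal (L x) \<partial>law p0)"
    using ae by (intro nn_integral_cong_AE) (auto simp: log_ratio_def L_def)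
  have neg: "(\<integral>\<^sup>+x. e2ennreal (- log_ratio (p0 x) (q x)) \<partial>law p0) = (\<integral>\<^sup>+x. ennreal (- L x) \<partial>law p0)"
    using ae by (intro nn_integral_cong_AE) (auto simp: log_ratio_def L_def e2ennreal_neg)
  obtain a b where ab: "(\<integral>\<^sup>+x. ennreal (L x) \<partial>law p0) = ennreal a" "(\<integral>\<^sup>+x. ennreal (- L x) \<partial>law p0) = ennreal b"
    "a \<ge> 0" "b \<ge> 0" "(\<integral>x. L x \<partial>law p0) = a - b"
    using int by (rule integrableE) auto
  have "ext_integral (law p0) (\<lambda>x. log_ratio (p0 x) (q x)) \<le> ereal (e\<^sup>2)"
    using q by (simp add: KL_nbhd_def)
  then show "(\<integral>x. L x \<partial>law p0) \<le> e\<^sup>2"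
    unfolding ext_integral_def pos neg ab using ab by (simp add: enn2ereal_ennreal)
qed

text \<open>The log-likelihood ratio is minus a sum of \<open>n\<close> independent copies of
  \<open>L\<close>, each with mean and variance at most \<open>e\<^sup>2\<close>. Falling below
  \<open>- 2 * n * e\<^sup>2\<close> forces the centred sum to be at least
  \<open>n * e\<^sup>2\<close> in modulus, and Chebyshev's inequality applies.\<close>

lemma (in prob_space) likelihood_ratio_lower_bound:
  fixes X :: "nat \<Rightarrow> 'a \<Rightarrow> real"
  assumes ind: "indep_vars (\<lambda>_. borel) X {1..n}"
    and X: "\<And>i. i \<in> {1..n} \<Longrightarrow> distr M borel (X i) = law p0"
    and p0: "prob_density p0" and q: "q \<in> KL_nbhd F p0 e" "prob_density q"
    and pos: "e > 0" "n \<ge> 1"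
  shows "prob {\<omega> \<in> space M. likelihood_ratio p0 n (\<lambda>i. X i \<omega>) q < exp (- (2 * real n * e\<^sup>2))} \<le> 1 / (real n * e\<^sup>2)"
proof -
  have [measurable]: "p0 \<in> borel_measurable borel" "q \<in> borel_measurable borel"
    using p0 q by (simp_all add: prob_density_def)
  have nn: "0 \<le> p0 x" "0 \<le> q x" for x using p0 q by (simp_all add: prob_density_def)
  have [measurable]: "X i \<in> borel_measurable M" if "i \<in> {1..n}" for i
    using ind that by (auto simp: indep_vars_def)
  define L where "L = (\<lambda>x. ln (p0 x / q x))"
  have [measurable]: "L \<in> borel_measurable borel" unfolding L_def by measurable
  have KL: "AE x in law p0. q x \<noteq> 0" "integrable (law p0) L" "integrable (law p0) (\<lambda>x. (L x)\<^sup>2)"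
    "(\<integral>x. L x \<partial>law p0) \<le> e\<^sup>2" "(\<integral>x. (L x)\<^sup>2 \<partial>law p0) \<le> e\<^sup>2"
    using KL_nbhd_log_ratio[OF q(1) \<open>q \<in> borel_measurable borel\<close> p0] by (simp_all add: L_def)
  interpret P: real_distribution "law p0" using p0 by (rule real_distribution_law)
  define m where "m = (\<integral>x. L x \<partial>law p0)"
  define Y where "Y i \<omega> = L (X i \<omega>) - m" for i \<omega>
  have Yd: "expectation (\<lambda>\<omega>. g (X i \<omega>)) = (\<integral>x. g x \<partial>law p0)"
    if "i \<in> {1..n}" "g \<in> borel_measurable borel" for i and g :: "real \<Rightarrow> real"
    using that by (simp flip: X[OF that(1)] add: integral_distr)
  have Yi: "integrable M (\<lambda>\<omega>. g (X i \<omega>)) \<longleftrightarrow> integrable (law p0) g"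
    if "i \<in> {1..n}" "g \<in> borel_measurable borel" for i and g :: "real \<Rightarrow> real"
    using that by (simp flip: X[OF that(1)] add: integrable_distr_eq)
  have sq: "(L x - m)\<^sup>2 = (L x)\<^sup>2 - 2 * m * L x + m\<^sup>2" for x
    by (simp add: power2_diff)
  have Lint: "integrable (law p0) (\<lambda>x. (L x - m)\<^sup>2)"
    unfolding sq using KL by auto
  have "(\<integral>x. (L x - m)\<^sup>2 \<partial>law p0) = (\<integral>x. (L x)\<^sup>2 \<partial>law p0) - m\<^sup>2"
    unfolding sq using KL P.prob_space by (simp add: m_def[symmetric] power2_eq_square)
  then have Lvar: "(\<integral>x. (L x - m)\<^sup>2 \<partial>law p0) \<le> e\<^sup>2"
    using KL(5) zero_le_power2[of m] by linarith
  have indY: "indep_vars (\<lambda>_. borel) Y {1..n}"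
    using indep_vars_compose2[OF ind, of "\<lambda>_ x. L x - m" "\<lambda>_. borel"] by (simp add: Y_def[abs_def])
  have Y0: "expectation (Y i) = 0" if "i \<in> {1..n}" for i
    using Yd[OF that, of "\<lambda>x. L x - m"] KL P.prob_space by (simp add: Y_def[abs_def] m_def)
  have Y2: "integrable M (\<lambda>\<omega>. (Y i \<omega>)\<^sup>2)" "expectation (\<lambda>\<omega>. (Y i \<omega>)\<^sup>2) \<le> e\<^sup>2" if "i \<in> {1..n}" for i
    using Yi[OF that, of "\<lambda>x. (L x - m)\<^sup>2"] Yd[OF that, of "\<lambda>x. (L x - m)\<^sup>2"] Lint Lvar
    by (simp_all add: Y_def)
  let ?S = "\<lambda>\<omega>. \<Sum>i=1..n. Y i \<omega>"
  have S: "integrable M (\<lambda>\<omega>. (?S \<omega>)\<^sup>2)"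
    "expectation (\<lambda>\<omega>. (?S \<omega>)\<^sup>2) = (\<Sum>i=1..n. expectation (\<lambda>\<omega>. (Y i \<omega>)\<^sup>2))"
    using indep_vars_centered_sum_square[OF _ indY] Y0 Y2 by auto
  have ES: "expectation (\<lambda>\<omega>. (?S \<omega>)\<^sup>2) \<le> real n * e\<^sup>2"
    unfolding S(2) using sum_mono[of "{1..n}" "\<lambda>i. expectation (\<lambda>\<omega>. (Y i \<omega>)\<^sup>2)" "\<lambda>_. e\<^sup>2"] Y2 by simp
  have Ym[measurable]: "Y i \<in> borel_measurable M" if "i \<in> {1..n}" for i
    using that unfolding Y_def by measurable
  have Sm[measurable]: "?S \<in> borel_measurable M"
    by measurable
  \<comment> \<open>At a zero of either density the quotient is 0 in HOL while
    \<open>exp (- L)\<close> is 1, so the exponential form of the likelihood ratio needs positivity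
    at the observations.\<close>
  have ae: "AE \<omega> in M. \<forall>i\<in>{1..n}. p0 (X i \<omega>) > 0 \<and> q (X i \<omega>) > 0"
  proof (rule AE_finite_allI)
    fix i assume i: "i \<in> {1..n}"
    have "AE x in law p0. p0 x \<noteq> 0"
      unfolding law_def by (subst AE_density) auto
    with KL(1) have "AE x in distr M borel (X i). p0 x > 0 \<and> q x > 0"
      unfolding X[OF i] by eventually_elim (use nn in \<open>auto simp: less_le\<close>)
    then show "AE \<omega> in M. p0 (X i \<omega>) > 0 \<and> q (X i \<omega>) > 0"
      using i by (subst (asm) AE_distr_iff) auto
  qed simp
  have "prob {\<omega> \<in> space M. likelihood_ratio p0 n (\<lambda>i. X i \<omega>) q < exp (- (2 * real n * e\<^sup>2))}
      \<le> prob {\<omega> \<in> space M. \<bar>?S \<omega>\<bar> \<ge> real n * e\<^sup>2}"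
  proof (rule finite_measure_mono_AE)
    show "AE \<omega> in M. \<omega> \<in> {\<omega> \<in> space M. likelihood_ratio p0 n (\<lambda>i. X i \<omega>) q < exp (- (2 * real n * e\<^sup>2))} \<longrightarrow>
        \<omega> \<in> {\<omega> \<in> space M. \<bar>?S \<omega>\<bar> \<ge> real n * e\<^sup>2}"
      using ae
    proof eventually_elim
      case (elim \<omega>)
      have "exp (- (\<Sum>i=1..n. L (X i \<omega>))) = (\<Prod>i=1..n. exp (- L (X i \<omega>)))"
        by (simp add: exp_sum flip: sum_negf)
      also have "\<dots> = likelihood_ratio p0 n (\<lambda>i. X i \<omega>) q"
        unfolding likelihood_ratio_def
        by (intro prod.cong refl) (use elim in \<open>auto simp: L_def exp_minus\<close>)
      finally have lr: "likelihood_ratio p0 n (\<lambda>i. X i \<omega>) q = exp (- (\<Sum>i=1..n. L (X i \<omega>)))" ..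
      have "real n * m \<le> real n * e\<^sup>2" using KL(4) by (intro mult_left_mono) (auto simp: m_def)
      then show ?case
        by (auto simp: lr Y_def sum_subtractf)
    qed
    have "{\<omega> \<in> space M. real n * e\<^sup>2 \<le> \<bar>?S \<omega>\<bar>} \<in> events" by measurable
    then show "{\<omega> \<in> space M. real n * e\<^sup>2 \<le> \<bar>?S \<omega>\<bar>} \<in> events" .
  qed
  also have "\<dots> \<le> expectation (\<lambda>\<omega>. (?S \<omega>)\<^sup>2) / (real n * e\<^sup>2)\<^sup>2"
    using pos S(1) by (intro second_moment_method) auto
  also have "\<dots> \<le> real n * e\<^sup>2 / (real n * e\<^sup>2)\<^sup>2"
    using ES by (rule divide_right_mono) simp
  also have "\<dots> = 1 / (real n * e\<^sup>2)"
    using pos by (simp add: power2_eq_square)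
  finally show ?thesis .
qed

lemma borel_measurable_likelihood_ratio:
  assumes F: "density_model F" and [measurable_cong]: "sets \<mu> = sets (weak_borel F)"
    and [measurable]: "p0 \<in> borel_measurable borel" "\<And>i. i \<in> {1..n} \<Longrightarrow> X i \<in> borel_measurable M"
  shows "(\<lambda>(q, \<omega>). likelihood_ratio p0 n (\<lambda>i. X i \<omega>) q) \<in> borel_measurable (\<mu> \<Otimes>\<^sub>M M)"
proof -
  have "(\<lambda>z. (\<lambda>(q, x). q x) (fst z, X i (snd z))) \<in> borel_measurable (\<mu> \<Otimes>\<^sub>M M)" if "i \<in> {1..n}" for i
    by (rule measurable_compose[OF _ conjunct2[OF F[unfolded density_model_def]]]) (use that in measurable)
  then have [measurable]: "(\<lambda>z. fst z (X i (snd z))) \<in> borel_measurable (\<mu> \<Otimes>\<^sub>M M)" if "i \<in> {1..n}" for i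
    using that by simp
  show ?thesis
    unfolding likelihood_ratio_def split_beta by measurable
qed

text \<open>Let \<open>g\<close> be the prior mass of those \<open>q\<close> in the neighbourhood
  whose likelihood ratio is below \<open>c\<close>. If \<open>g\<close> is less than half the mass
  of the neighbourhood, the rest contributes at least \<open>c\<close> times the other half. By
  Fubini's theorem the expectation of \<open>g\<close> is at most \<open>\<beta>\<close> times that
  mass, so Markov's inequality bounds the failure probability by \<open>2 * \<beta>\<close>.\<close>

lemma (in prob_space) evidence_lower_bound:
  fixes X :: "nat \<Rightarrow> 'a \<Rightarrow> real"
  assumes ind: "indep_vars (\<lambda>_. borel) X {1..n}"
    and X: "\<And>i. i \<in> {1..n} \<Longrightarrow> distr M borel (X i) = law p0"
    and p0: "prob_density p0" and F: "density_model F" and \<mu>: "prior_on F \<mu>"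
    and mass: "measure \<mu> (KL_nbhd F p0 e) \<ge> exp (- (real n * e\<^sup>2))"
    and pos: "e > 0" "n \<ge> 1"
  shows "prob {\<omega> \<in> space M. (\<integral>\<^sup>+q. ennreal (likelihood_ratio p0 n (\<lambda>i. X i \<omega>) q) \<partial>\<mu>)
      < ennreal (exp (- (3 * real n * e\<^sup>2)) / 2)} \<le> 2 / (real n * e\<^sup>2)"
proof -
  interpret \<mu>: prob_space \<mu> using \<mu> by (simp add: prior_on_def)
  have s\<mu>[measurable_cong]: "sets \<mu> = sets (weak_borel F)" using \<mu> by (simp add: prior_on_def)
  interpret pair_sigma_finite \<mu> M ..
  have [measurable]: "p0 \<in> borel_measurable borel" using p0 by (simp add: prob_density_def)
  have [measurable]: "X i \<in> borel_measurable M" if "i \<in> {1..n}" for i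
    using ind that by (auto simp: indep_vars_def)
  let ?LR = "\<lambda>q \<omega>. likelihood_ratio p0 n (\<lambda>i. X i \<omega>) q"
  let ?S = "KL_nbhd F p0 e"
  define c where "c = exp (- (2 * real n * e\<^sup>2))"
  define \<beta> where "\<beta> = 1 / (real n * e\<^sup>2)"
  have c: "c > 0" and \<beta>: "\<beta> > 0" using pos by (auto simp: c_def \<beta>_def)
  have LR[measurable]: "(\<lambda>(q, \<omega>). ?LR q \<omega>) \<in> borel_measurable (\<mu> \<Otimes>\<^sub>M M)"
    by (rule borel_measurable_likelihood_ratio[OF F s\<mu>]) auto
  \<comment> \<open>Non-measurable sets have measure 0 in HOL, so the positive prior mass already
    shows that the neighbourhood is measurable.\<close>
  have S0: "measure \<mu> ?S > 0" using mass by (rule less_le_trans[rotated]) simp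
  then have S[measurable]: "?S \<in> sets \<mu>"
    using measure_notin_sets by fastforce
  define g where "g \<omega> = (\<integral>\<^sup>+q. indicator ?S q * (if ?LR q \<omega> < c then 1 else 0) \<partial>\<mu>)" for \<omega>
  have gm: "(\<lambda>(q, \<omega>). indicator ?S q * (if ?LR q \<omega> < c then 1 else 0) :: ennreal) \<in> borel_measurable (\<mu> \<Otimes>\<^sub>M M)"
    by measurable
  have [measurable]: "g \<in> borel_measurable M"
    unfolding g_def using gm by measurable
  have Eg: "(\<integral>\<^sup>+\<omega>. g \<omega> \<partial>M) \<le> ennreal (measure \<mu> ?S * \<beta>)"
  proof -
    have "(\<integral>\<^sup>+\<omega>. g \<omega> \<partial>M) = (\<integral>\<^sup>+q. (\<integral>\<^sup>+\<omega>. indicator ?S q * (if ?LR q \<omega> < c then 1 else 0) \<partial>M) \<partial>\<mu>)"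
      unfolding g_def by (rule Fubini'[OF gm])
    also have "\<dots> \<le> (\<integral>\<^sup>+q. ennreal \<beta> * indicator ?S q \<partial>\<mu>)"
    proof (rule nn_integral_mono)
      fix q assume "q \<in> space \<mu>"
      show "(\<integral>\<^sup>+\<omega>. indicator ?S q * (if ?LR q \<omega> < c then 1 else 0) \<partial>M) \<le> ennreal \<beta> * indicator ?S q"
      proof (cases "q \<in> ?S")
        case True
        then have q: "prob_density q" using F by (auto simp: KL_nbhd_def density_model_def)
        have [measurable]: "q \<in> borel_measurable borel" using q by (simp add: prob_density_def)
        have [measurable]: "?LR q \<in> borel_measurable M"
          unfolding likelihood_ratio_def by measurable
        have "(\<integral>\<^sup>+\<omega>. indicator ?S q * (if ?LR q \<omega> < c then 1 else 0) \<partial>M)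
            = (\<integral>\<^sup>+\<omega>. indicator {\<omega> \<in> space M. ?LR q \<omega> < c} \<omega> \<partial>M)"
          using True by (intro nn_integral_cong) (auto simp: indicator_def)
        also have "\<dots> = ennreal (prob {\<omega> \<in> space M. ?LR q \<omega> < c})"
          by (simp add: emeasure_eq_measure)
        also have "\<dots> \<le> ennreal \<beta>"
          unfolding c_def \<beta>_def using True q pos
          by (intro ennreal_leI likelihood_ratio_lower_bound[OF ind X p0]) auto
        finally show ?thesis using True by simp
      qed simp
    qed
    also have "\<dots> = ennreal (measure \<mu> ?S * \<beta>)"
      using \<beta> by (simp add: nn_integral_cmult_indicator \<mu>.emeasure_eq_measure mult.commute flip: ennreal_mult)
    finally show ?thesis .
  qed
  have sub: "{\<omega> \<in> space M. (\<integral>\<^sup>+q. ennreal (?LR q \<omega>) \<partial>\<mu>) < ennreal (exp (- (3 * real n * e\<^sup>2)) / 2)}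
      \<subseteq> {\<omega> \<in> space M. 1 \<le> ennreal (2 / measure \<mu> ?S) * g \<omega>}"
  proof safe
    fix \<omega> assume \<omega>: "\<omega> \<in> space M"
      and D: "(\<integral>\<^sup>+q. ennreal (?LR q \<omega>) \<partial>\<mu>) < ennreal (exp (- (3 * real n * e\<^sup>2)) / 2)"
    have [measurable]: "(\<lambda>q. ?LR q \<omega>) \<in> borel_measurable \<mu>"
      using measurable_Pair1[OF LR] \<omega> by simp
    obtain d where d: "(\<integral>\<^sup>+q. ennreal (?LR q \<omega>) \<partial>\<mu>) = ennreal d" "d \<ge> 0"
      using D by (cases "\<integral>\<^sup>+q. ennreal (?LR q \<omega>) \<partial>\<mu>") auto
    have "g \<omega> \<le> (\<integral>\<^sup>+q. 1 \<partial>\<mu>)"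
      unfolding g_def by (intro nn_integral_mono) (auto simp: indicator_def)
    then have "g \<omega> \<le> 1" by (simp add: \<mu>.emeasure_space_1)
    then obtain h where h: "g \<omega> = ennreal h" "h \<ge> 0"
      by (cases "g \<omega>") (auto simp: top_unique)
    have "ennreal (c * measure \<mu> ?S) = (\<integral>\<^sup>+q. ennreal c * indicator ?S q \<partial>\<mu>)"
      using c by (simp add: nn_integral_cmult_indicator \<mu>.emeasure_eq_measure ennreal_mult)
    \<comment> \<open>On the neighbourhood, either the likelihood ratio is at least \<open>c\<close>
      or the second summand equals \<open>c\<close>.\<close>
    also have "\<dots> \<le> (\<integral>\<^sup>+q. ennreal (?LR q \<omega>) + ennreal c * (indicator ?S q * (if ?LR q \<omega> < c then 1 else 0)) \<partial>\<mu>)"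
      by (intro nn_integral_mono) (auto simp: indicator_def ennreal_leI)
    also have "\<dots> = ennreal d + ennreal c * g \<omega>"
      unfolding g_def d(1)[symmetric] by (subst nn_integral_add) (auto simp: nn_integral_cmult)
    also have "\<dots> = ennreal (d + c * h)"
      using d h c by (simp flip: ennreal_mult ennreal_plus)
    finally have "c * measure \<mu> ?S \<le> d + c * h"
      using d h c by (subst (asm) ennreal_le_iff) auto
    moreover have "2 * d \<le> c * measure \<mu> ?S"
    proof -
      have "2 * d < exp (- (3 * real n * e\<^sup>2))" using D d by (simp add: ennreal_less_iff)
      also have "\<dots> = c * exp (- (real n * e\<^sup>2))" by (simp add: c_def flip: exp_add)
      also have "\<dots> \<le> c * measure \<mu> ?S" using mass c by (intro mult_left_mono) auto
      finally show ?thesis by simp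
    qed
    ultimately have "c * measure \<mu> ?S \<le> c * (2 * h)" by (simp add: algebra_simps)
    then have "measure \<mu> ?S \<le> 2 * h" using c by simp
    then show "1 \<le> ennreal (2 / measure \<mu> ?S) * g \<omega>"
      using S0 h by (simp flip: ennreal_mult)
  qed
  have "prob {\<omega> \<in> space M. (\<integral>\<^sup>+q. ennreal (?LR q \<omega>) \<partial>\<mu>) < ennreal (exp (- (3 * real n * e\<^sup>2)) / 2)}
      \<le> prob {\<omega> \<in> space M. 1 \<le> ennreal (2 / measure \<mu> ?S) * g \<omega>}"
    by (rule finite_measure_mono[OF sub]) measurable
  also have "\<dots> \<le> 2 * \<beta>"
  proof -
    have "emeasure M {\<omega> \<in> space M. 1 \<le> ennreal (2 / measure \<mu> ?S) * g \<omega>}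
        \<le> ennreal (2 / measure \<mu> ?S) * (\<integral>\<^sup>+\<omega>. g \<omega> * indicator (space M) \<omega> \<partial>M)"
      by (rule nn_integral_Markov_inequality) auto
    also have "(\<integral>\<^sup>+\<omega>. g \<omega> * indicator (space M) \<omega> \<partial>M) = (\<integral>\<^sup>+\<omega>. g \<omega> \<partial>M)"
      by (intro nn_integral_cong) auto
    also have "ennreal (2 / measure \<mu> ?S) * \<dots> \<le> ennreal (2 / measure \<mu> ?S) * ennreal (measure \<mu> ?S * \<beta>)"
      using Eg by (rule mult_left_mono) simp
    also have "\<dots> = ennreal (2 * \<beta>)"
      using S0 \<beta> by (simp flip: ennreal_mult)
    finally show ?thesis using \<beta> by (simp add: emeasure_eq_measure)
  qed
  finally show ?thesis by (simp add: \<beta>_def)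
qed

section \<open>Posterior contraction\<close>

lemma measurable_moment_set:
  assumes F: "density_model F" and s\<mu>: "sets \<mu> = sets (weak_borel F)"
  shows "{q \<in> F. abs_moment r (law q) \<le> ennreal K} \<in> sets \<mu>"
proof -
  have [measurable_cong]: "sets \<mu> = sets (weak_borel F)" by fact
  have sp: "space \<mu> = F" using sets_eq_imp_space_eq[OF s\<mu>] by simp
  have qx[measurable]: "(\<lambda>(q, x). q x) \<in> borel_measurable (\<mu> \<Otimes>\<^sub>M borel)"
    using F measurable_cong_sets[OF sets_pair_measure_cong[OF s\<mu> refl] refl]
    by (auto simp: density_model_def)
  have m: "(\<lambda>q. \<integral>\<^sup>+x. ennreal ((\<lambda>(q, x). q x) (q, x)) * ennreal (\<bar>x\<bar> powr r) \<partial>lborel) \<in> borel_measurable \<mu>"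
    by measurable
  have "{q \<in> F. abs_moment r (law q) \<le> ennreal K} =
      {q \<in> space \<mu>. (\<integral>\<^sup>+x. ennreal ((\<lambda>(q, x). q x) (q, x)) * ennreal (\<bar>x\<bar> powr r) \<partial>lborel) \<le> ennreal K}"
    using F by (auto simp: sp abs_moment_def law_def nn_integral_density density_model_def prob_density_def)
  also have "\<dots> \<in> sets \<mu>" using m by measurable
  finally show ?thesis .
qed

text \<open>The distribution function is the integral of the jointly measurable evaluation
  \<open>(q, x) \<mapsto> q x\<close> over a half-line. Joint measurability in \<open>q\<close> and
  \<open>y\<close> is what makes \<open>exp_dev\<close> accessible to Fubini's theorem over the
  prior and the data.\<close>

lemma borel_measurable_cdf_law:
  assumes F: "density_model F" and s\<mu>: "sets \<mu> = sets (weak_borel F)"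
  shows "(\<lambda>(q, y). cdf (law q) y) \<in> borel_measurable (\<mu> \<Otimes>\<^sub>M borel)"
proof -
  have sp: "space \<mu> = F" using sets_eq_imp_space_eq[OF s\<mu>] by simp
  have qx[measurable]: "(\<lambda>(q, x). q x) \<in> borel_measurable (\<mu> \<Otimes>\<^sub>M borel)"
    using F measurable_cong_sets[OF sets_pair_measure_cong[OF s\<mu> refl] refl]
    by (auto simp: density_model_def)
  let ?I = "\<lambda>z. enn2real (\<integral>\<^sup>+x. ennreal ((\<lambda>(q, x). q x) (fst z, x)) * (if x \<le> snd z then 1 else 0) \<partial>lborel)"
  have m: "?I \<in> borel_measurable (\<mu> \<Otimes>\<^sub>M (borel :: real measure))"
    by measurable
  have "(\<lambda>(q, y). cdf (law q) y) \<in> borel_measurable (\<mu> \<Otimes>\<^sub>M borel) \<longleftrightarrow> ?I \<in> borel_measurable (\<mu> \<Otimes>\<^sub>M borel)"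
  proof (rule measurable_cong)
    fix z assume "z \<in> space (\<mu> \<Otimes>\<^sub>M (borel :: real measure))"
    then obtain q y where z: "z = (q, y)" "q \<in> F" by (auto simp: space_pair_measure sp)
    have [measurable]: "q \<in> borel_measurable borel"
      using F z by (auto simp: density_model_def prob_density_def)
    have "emeasure (law q) {..y} = (\<integral>\<^sup>+x. ennreal (q x) * (if x \<le> y then 1 else 0) \<partial>lborel)"
      by (auto simp: law_def emeasure_density indicator_def intro!: nn_integral_cong)
    then show "(case z of (q, y) \<Rightarrow> cdf (law q) y) = ?I z"
      by (simp add: z cdf_def measure_def)
  qed
  then show ?thesis using m by simp
qed

lemma borel_measurable_exp_dev_law:
  assumes F: "density_model F" and s\<mu>: "sets \<mu> = sets (weak_borel F)"
    and X[measurable]: "\<And>i. i \<in> {1..n} \<Longrightarrow> X i \<in> borel_measurable M"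
    and \<nu>: "sigma_finite_measure \<nu>" "sets \<nu> = sets borel" and s[measurable]: "s \<in> borel_measurable borel"
  shows "(\<lambda>(q, \<omega>). exp_dev \<nu> s n (\<lambda>i. X i \<omega>) (cdf (law q))) \<in> borel_measurable (\<mu> \<Otimes>\<^sub>M M)"
proof -
  interpret sigma_finite_measure \<nu> by fact
  have [measurable_cong]: "sets \<nu> = sets borel" by fact
  have c[measurable]: "(\<lambda>z. (\<lambda>(q, y). cdf (law q) y) (fst (fst z), snd z)) \<in> borel_measurable ((\<mu> \<Otimes>\<^sub>M M) \<Otimes>\<^sub>M \<nu>)"
    by (rule measurable_compose[OF _ borel_measurable_cdf_law[OF F s\<mu>]]) measurable
  have "(\<lambda>z. ennreal (exp (s (snd z) * \<bar>\<Sum>i=1..n. indicator {..snd z} (X i (snd (fst z))) -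
      (\<lambda>(q, y). cdf (law q) y) (fst (fst z), snd z)\<bar>))) \<in> borel_measurable ((\<mu> \<Otimes>\<^sub>M M) \<Otimes>\<^sub>M \<nu>)"
    unfolding indicator_def atMost_iff by measurable
  then show ?thesis
    unfolding exp_dev_def split_beta
    by (intro borel_measurable_nn_integral) (simp add: split_beta)
qed

lemma borel_measurable_exp_dev:
  assumes X[measurable]: "\<And>i. i \<in> {1..n} \<Longrightarrow> X i \<in> borel_measurable M"
    and \<nu>: "sigma_finite_measure \<nu>" "sets \<nu> = sets borel"
    and [measurable]: "s \<in> borel_measurable borel" "G \<in> borel_measurable borel"
  shows "(\<lambda>\<omega>. exp_dev \<nu> s n (\<lambda>i. X i \<omega>) G) \<in> borel_measurable M"
proof -
  interpret sigma_finite_measure \<nu> by fact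
  have [measurable_cong]: "sets \<nu> = sets borel" by fact
  show ?thesis
    unfolding exp_dev_def indicator_def atMost_iff by measurable
qed

lemma borel_measurable_posterior:
  assumes F: "density_model F" and \<mu>: "prior_on F \<mu>" and A: "A \<in> sets \<mu>"
    and p0: "p0 \<in> borel_measurable borel" and X: "\<And>i. i \<in> {1..n} \<Longrightarrow> X i \<in> borel_measurable M"
  shows "(\<lambda>\<omega>. posterior p0 \<mu> n (\<lambda>i. X i \<omega>) A) \<in> borel_measurable M"
proof -
  interpret \<mu>: prob_space \<mu> using \<mu> by (simp add: prior_on_def)
  have s\<mu>: "sets \<mu> = sets (weak_borel F)" using \<mu> by (simp add: prior_on_def)
  note [measurable] = A
  have [measurable]: "(\<lambda>z. likelihood_ratio p0 n (\<lambda>i. X i (fst z)) (snd z)) \<in> borel_measurable (M \<Otimes>\<^sub>M \<mu>)"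
    using measurable_compose[OF measurable_pair_swap' borel_measurable_likelihood_ratio[OF F s\<mu> p0 X]]
    by (simp add: split_beta)
  show ?thesis
    unfolding posterior_def by measurable
qed

section \<open>Posterior mass at a fixed sample size\<close>

text \<open>In the application \<open>D\<close> is the evidence, and \<open>N\<close>,
  \<open>N'\<close> and \<open>G\<close> are the unnormalised posterior masses of the set of
  interest, of the complement of the moment set and of the moment set. Dividing by \<open>D\<close>
  turns \<open>N'\<close> into one minus the posterior probability of the moment set.\<close>

lemma enn2real_ratio_le:
  fixes D :: ennreal
  assumes "N \<le> N' + ennreal t * D" "N' + G = D" "0 < D" "0 \<le> t"
  shows "enn2real (N / D) \<le> \<bar>enn2real (G / D) - 1\<bar> + t"
proof (cases "D = top")
  \<comment> \<open>A quotient by \<open>\<infinity>\<close> is 0, so the left-hand side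
    vanishes.\<close>
  case True
  then show ?thesis using assms by (simp add: ennreal_divide_top)
next
  case False
  then obtain d where d: "D = ennreal d" "d > 0"
    using assms by (cases D) auto
  have "N' \<noteq> top" "G \<noteq> top" using assms(2) False by auto
  then obtain a b where ab: "N' = ennreal a" "G = ennreal b" "a \<ge> 0" "b \<ge> 0"
    by (metis ennreal_cases)
  have sum: "a + b = d" using assms(2) ab d by (simp flip: ennreal_plus)
  have N: "N \<le> ennreal (a + t * d)"
    using assms(1,4) ab d by (simp flip: ennreal_mult ennreal_plus)
  then obtain c where c: "N = ennreal c" "c \<ge> 0"
    by (cases N) (auto simp: top_unique)
  have "c \<le> a + t * d"
    using N c ab d assms(4) by (subst (asm) c(1)) (simp add: ennreal_le_iff del: ennreal_plus)
  then have "c / d \<le> a / d + t" using d by (simp add: field_simps)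
  also have "a / d = 1 - b / d" using sum d by (simp add: field_simps)
  finally show ?thesis
    using ab c d by (simp add: divide_ennreal)
qed

lemma exp_minus_le_inverse: "x > 0 \<Longrightarrow> exp (- x) \<le> 1 / (x :: real)"
  using exp_ge_add_one_self[of x] by (simp add: exp_minus field_simps del: exp_ge_add_one_self)

text \<open>
  The exceptional event \<open>E\<close> is explicit because \<open>A\<close>, hence the posterior probability of \<open>A\<close> as a function
  of the data, need not be measurable.
\<close>
lemma (in prob_space) posterior_wasserstein_bound:
  fixes X :: "nat \<Rightarrow> 'a \<Rightarrow> real"
  assumes ind: "indep_vars (\<lambda>_. borel) X {1..n}"
    and X: "\<And>i. i \<in> {1..n} \<Longrightarrow> distr M borel (X i) = law p0"
    and p0: "prob_density p0" and F: "density_model F" and \<mu>: "prior_on F \<mu>"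
    and mass: "measure \<mu> (KL_nbhd F p0 e) \<ge> exp (- (real n * e\<^sup>2))"
    and pos: "e > 0" "n \<ge> 1" "p \<ge> 1" "\<delta> > 0" "K \<ge> 0" "t > 0"
    and mom: "abs_moment (2 * p + \<delta>) (law p0) \<le> ennreal K"
  defines "C \<equiv> 2 powr (2 * p + \<delta>) * (1 + K)"
  assumes K1: "K1 \<le> K"
    and A: "A \<subseteq> {q \<in> F. ennreal_rpow (wasserstein p (law q) (law p0)) p >
        ennreal (4 powr p * (4 / \<delta>) * ((2 * (C + 4) + 2 * C) * e))}"
  obtains E where "E \<in> events" "prob E \<le> (4 + 4 / t) / (real n * e\<^sup>2)"
    "\<And>\<omega>. \<omega> \<in> space M - E \<Longrightarrow> posterior p0 \<mu> n (\<lambda>i. X i \<omega>) A \<le>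
      \<bar>posterior p0 \<mu> n (\<lambda>i. X i \<omega>) {q \<in> F. abs_moment (2 * p + \<delta>) (law q) \<le> ennreal K1} - 1\<bar> + t"
proof -
  interpret \<mu>: prob_space \<mu> using \<mu> by (simp add: prior_on_def)
  have s\<mu>[measurable_cong]: "sets \<mu> = sets (weak_borel F)" using \<mu> by (simp add: prior_on_def)
  have sp: "space \<mu> = F" using sets_eq_imp_space_eq[OF s\<mu>] by simp
  interpret pair_sigma_finite \<mu> M ..
  interpret P: real_distribution "law p0" using p0 by (rule real_distribution_law)
  interpret \<nu>: prob_space "pareto (\<delta> / 2)" using pos by (intro prob_space_pareto) auto
  have p0m[measurable]: "p0 \<in> borel_measurable borel" using p0 by (simp add: prob_density_def)
  have Xm[measurable]: "X i \<in> borel_measurable M" if "i \<in> {1..n}" for i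
    using ind that by (auto simp: indep_vars_def)
  define G where "G = {q \<in> F. abs_moment (2 * p + \<delta>) (law q) \<le> ennreal K1}"
  have Gm[measurable]: "G \<in> sets \<mu>" unfolding G_def by (rule measurable_moment_set[OF F s\<mu>])
  have G: "real_distribution (law q)" "prob_density q" "abs_moment (2 * p + \<delta>) (law q) \<le> ennreal K" if "q \<in> G" for q
    using that F K1 by (auto simp: G_def density_model_def intro: real_distribution_law order_trans ennreal_leI)
  let ?s = "cut_weight (p + \<delta> / 2) e"
  let ?R = "\<lambda>q \<omega>. exp_dev (pareto (\<delta> / 2)) ?s n (\<lambda>i. X i \<omega>) (cdf (law q))"
  let ?LR = "\<lambda>q \<omega>. likelihood_ratio p0 n (\<lambda>i. X i \<omega>) q"
  let ?D = "\<lambda>\<omega>. \<integral>\<^sup>+q. ennreal (?LR q \<omega>) \<partial>\<mu>"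
  define x where "x = real n * e\<^sup>2"
  \<comment> \<open>Threshold for the deviation functional, whose expectation is of order
    \<open>exp (x * C)\<close>. Of the surplus 4 in the exponent, 3 pays for the evidence bound
    \<open>exp (- (3 * x)) / 2\<close> and 1 leaves an error probability of order
    \<open>exp (- x)\<close>.\<close>
  define b where "b = exp (x * (C + 4))"
  have x: "x > 0" using pos by (simp add: x_def)
  have b0: "b > 0" by (simp add: b_def)
  have C0: "C \<ge> 0" using pos by (simp add: C_def)
  have r2: "2 * (p + \<delta> / 2) = 2 * p + \<delta>" by simp
  \<comment> \<open>Stated for general \<open>f\<close> to serve twice: with \<open>f = 1\<close>
    for the true density and with \<open>f = q / p0\<close> under the prior.\<close>
  have R_le: "(\<integral>\<^sup>+\<omega>. (\<Prod>i=1..n. f (X i \<omega>)) * ?R q \<omega> \<partial>M) \<le> ennreal (2 * exp (x * C))"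
    if q: "real_distribution (law q)" "abs_moment (2 * p + \<delta>) (law q) \<le> ennreal K"
      and f: "f \<in> borel_measurable borel"
        "\<And>g. g \<in> borel_measurable borel \<Longrightarrow> (\<integral>\<^sup>+x. f x * g x \<partial>law p0) \<le> (\<integral>\<^sup>+x. g x \<partial>law q)" for q f
  proof -
    have "(\<integral>\<^sup>+\<omega>. (\<Prod>i=1..n. f (X i \<omega>)) * ?R q \<omega> \<partial>M) \<le> 2 * ennreal (exp (real n * (e\<^sup>2 * C)))"
      using cut_weight_bounds[of e] real_distribution.cut_weight_variance_le[OF q(1), of "p + \<delta> / 2" K] q pos
      by (intro nn_integral_likelihood_exp_dev_le[OF ind X q(1) f(1) f(2)])
        (auto simp: C_def \<nu>.prob_space_axioms simp del: One_nat_def)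
    then show ?thesis by (simp add: x_def ennreal_mult mult.assoc)
  qed
  have Rm[measurable]: "(\<lambda>(q, \<omega>). ?R q \<omega>) \<in> borel_measurable (\<mu> \<Otimes>\<^sub>M M)"
    by (rule borel_measurable_exp_dev_law[OF F s\<mu> Xm]) (auto intro: \<nu>.sigma_finite_measure_axioms)
  have R0m[measurable]: "?R p0 \<in> borel_measurable M"
    by (rule borel_measurable_exp_dev[OF Xm]) (auto intro: \<nu>.sigma_finite_measure_axioms)
  have LRm[measurable]: "(\<lambda>(q, \<omega>). ?LR q \<omega>) \<in> borel_measurable (\<mu> \<Otimes>\<^sub>M M)"
    by (rule borel_measurable_likelihood_ratio[OF F s\<mu> p0m Xm])
  have Dm[measurable]: "?D \<in> borel_measurable M"
    by measurable
  \<comment> \<open>Unnormalised posterior integral, over the moment set, of the deviation of the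
    sample from \<open>q\<close>. In expectation the likelihood ratio changes the law of the sample
    from that of \<open>p0\<close> to that of \<open>q\<close>, under which such deviations are
    small.\<close>
  define V where "V \<omega> = (\<integral>\<^sup>+q. indicator G q * (ennreal (?LR q \<omega>) * ?R q \<omega>) \<partial>\<mu>)" for \<omega>
  have Vjm: "(\<lambda>(q, \<omega>). indicator G q * (ennreal (?LR q \<omega>) * ?R q \<omega>)) \<in> borel_measurable (\<mu> \<Otimes>\<^sub>M M)"
    by measurable
  have Vm[measurable]: "V \<in> borel_measurable M"
    unfolding V_def using Vjm by measurable
  have EV: "(\<integral>\<^sup>+\<omega>. V \<omega> \<partial>M) \<le> ennreal (2 * exp (x * C))"
  proof -
    have "(\<integral>\<^sup>+\<omega>. V \<omega> \<partial>M) = (\<integral>\<^sup>+q. (\<integral>\<^sup>+\<omega>. indicator G q * (ennreal (?LR q \<omega>) * ?R q \<omega>) \<partial>M) \<partial>\<mu>)"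
      unfolding V_def by (rule Fubini'[OF Vjm])
    also have "\<dots> \<le> (\<integral>\<^sup>+q. ennreal (2 * exp (x * C)) \<partial>\<mu>)"
    proof (rule nn_integral_mono)
      fix q assume "q \<in> space \<mu>"
      show "(\<integral>\<^sup>+\<omega>. indicator G q * (ennreal (?LR q \<omega>) * ?R q \<omega>) \<partial>M) \<le> ennreal (2 * exp (x * C))"
      proof (cases "q \<in> G")
        case True
        have qm[measurable]: "q \<in> borel_measurable borel" and q0: "\<And>x. q x \<ge> 0"
          using G(2)[OF True] by (auto simp: prob_density_def)
        have p00: "\<And>x. p0 x \<ge> 0" using p0 by (auto simp: prob_density_def)
        have "(\<integral>\<^sup>+\<omega>. indicator G q * (ennreal (?LR q \<omega>) * ?R q \<omega>) \<partial>M) =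
            (\<integral>\<^sup>+\<omega>. (\<Prod>i=1..n. ennreal (q (X i \<omega>) / p0 (X i \<omega>))) * ?R q \<omega> \<partial>M)"
          using True q0 p00 by (simp add: likelihood_ratio_def prod_ennreal)
        also have "\<dots> \<le> ennreal (2 * exp (x * C))"
        proof (rule R_le[of q "\<lambda>x. ennreal (q x / p0 x)"])
          fix g :: "real \<Rightarrow> ennreal" assume [measurable]: "g \<in> borel_measurable borel"
          have "(\<integral>\<^sup>+x. ennreal (q x / p0 x) * g x \<partial>law p0) =
              (\<integral>\<^sup>+x. ennreal (p0 x) * (ennreal (q x / p0 x) * g x) \<partial>lborel)"
            unfolding law_def by (subst nn_integral_density) auto
          also have "\<dots> \<le> (\<integral>\<^sup>+x. ennreal (q x) * g x \<partial>lborel)"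
          proof (rule nn_integral_mono)
            fix x
            \<comment> \<open>Where \<open>p0\<close> vanishes the quotient is 0, so only an
              inequality holds.\<close>
            have "ennreal (p0 x) * ennreal (q x / p0 x) \<le> ennreal (q x)"
              using q0[of x] p00[of x] by (cases "p0 x = 0") (auto simp flip: ennreal_mult)
            then show "ennreal (p0 x) * (ennreal (q x / p0 x) * g x) \<le> ennreal (q x) * g x"
              unfolding mult.assoc[symmetric] by (rule mult_right_mono) simp
          qed
          also have "\<dots> = (\<integral>\<^sup>+x. g x \<partial>law q)"
            unfolding law_def by (subst nn_integral_density) auto
          finally show "(\<integral>\<^sup>+x. ennreal (q x / p0 x) * g x \<partial>law p0) \<le> (\<integral>\<^sup>+x. g x \<partial>law q)" .
        qed (use G[OF True] in auto)
        finally show ?thesis .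
      qed simp
    qed
    also have "\<dots> = ennreal (2 * exp (x * C))" by (simp add: \<mu>.emeasure_space_1)
    finally show ?thesis .
  qed
  have ER: "(\<integral>\<^sup>+\<omega>. ?R p0 \<omega> \<partial>M) \<le> ennreal (2 * exp (x * C))"
    using R_le[of p0 "\<lambda>_. 1"] mom by (simp add: P.real_distribution_axioms)
  have markov: "prob {\<omega> \<in> space M. 1 \<le> ennreal c * u \<omega>} \<le> c * (2 * exp (x * C))"
    if [measurable]: "u \<in> borel_measurable M" and "(\<integral>\<^sup>+\<omega>. u \<omega> \<partial>M) \<le> ennreal (2 * exp (x * C))" "c \<ge> 0" for u c
  proof -
    have "emeasure M {\<omega> \<in> space M. 1 \<le> ennreal c * u \<omega>} \<le> ennreal c * (\<integral>\<^sup>+\<omega>. u \<omega> * indicator (space M) \<omega> \<partial>M)"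
      by (rule nn_integral_Markov_inequality) auto
    also have "(\<integral>\<^sup>+\<omega>. u \<omega> * indicator (space M) \<omega> \<partial>M) = (\<integral>\<^sup>+\<omega>. u \<omega> \<partial>M)"
      by (intro nn_integral_cong) auto
    also have "ennreal c * \<dots> \<le> ennreal c * ennreal (2 * exp (x * C))"
      using that(2) by (rule mult_left_mono) simp
    also have "\<dots> = ennreal (c * (2 * exp (x * C)))"
      using that(3) by (simp flip: ennreal_mult)
    finally show ?thesis using that(3) by (simp add: emeasure_eq_measure)
  qed
  \<comment> \<open>Chosen so that \<open>V \<le> 1 / c\<close> makes \<open>V / b\<close> at most
    \<open>t\<close> times the lower bound of the evidence.\<close>
  define c where "c = exp (3 * x) * 2 / (t * b)"
  have c0: "c > 0" using pos b0 by (simp add: c_def)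
  \<comment> \<open>The three exceptional events: the sample does not fit \<open>p0\<close>, the
    evidence is too small, and \<open>V\<close> is too large.\<close>
  let ?E1 = "{\<omega> \<in> space M. 1 \<le> ennreal (1 / b) * ?R p0 \<omega>}"
  let ?E2 = "{\<omega> \<in> space M. ?D \<omega> < ennreal (exp (- (3 * real n * e\<^sup>2)) / 2)}"
  let ?E3 = "{\<omega> \<in> space M. 1 \<le> ennreal c * V \<omega>}"
  have E1: "prob ?E1 \<le> 2 / x"
  proof -
    have "prob ?E1 \<le> 1 / b * (2 * exp (x * C))"
      using b0 ER by (intro markov) auto
    also have "\<dots> = 2 * exp (- (4 * x))"
      by (simp add: b_def exp_minus distrib_left exp_add field_simps)
    also have "\<dots> \<le> 2 * exp (- x)" using x by simp
    also have "\<dots> \<le> 2 / x" using exp_minus_le_inverse[OF x] by simp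
    finally show ?thesis .
  qed
  have E3: "prob ?E3 \<le> 4 / t / x"
  proof -
    have "prob ?E3 \<le> c * (2 * exp (x * C))"
      using c0 EV by (intro markov) auto
    also have "\<dots> = 4 / t * exp (- x)"
    proof -
      have "exp (x * (C + 4)) = exp (3 * x) * exp x * exp (x * C)"
        by (simp add: algebra_simps flip: exp_add)
      then show ?thesis using pos by (simp add: c_def b_def exp_minus field_simps)
    qed
    also have "\<dots> \<le> 4 / t * (1 / x)" using exp_minus_le_inverse[OF x] pos by (intro mult_left_mono) auto
    finally show ?thesis by simp
  qed
  have E2: "prob ?E2 \<le> 2 / x"
    unfolding x_def by (rule evidence_lower_bound[OF ind X p0 F \<mu> mass pos(1,2)])
  have post: "posterior p0 \<mu> n (\<lambda>i. X i \<omega>) A \<le> \<bar>posterior p0 \<mu> n (\<lambda>i. X i \<omega>) G - 1\<bar> + t"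
    if \<omega>E: "\<omega> \<in> space M - (?E1 \<union> ?E2 \<union> ?E3)" for \<omega>
  proof -
    have \<omega>: "\<omega> \<in> space M" and n1: "ennreal (1 / b) * ?R p0 \<omega> < 1"
      and n2: "ennreal (exp (- (3 * x)) / 2) \<le> ?D \<omega>" and n3: "ennreal c * V \<omega> < 1"
      using \<omega>E by (auto simp: not_le not_less x_def mult.assoc)
    have [measurable]: "(\<lambda>q. ?LR q \<omega>) \<in> borel_measurable \<mu>" "(\<lambda>q. ?R q \<omega>) \<in> borel_measurable \<mu>"
      using measurable_Pair1[OF LRm] measurable_Pair1[OF Rm] \<omega> by simp_all
    have cancel: "u \<le> ennreal d" if "ennreal (1 / d) * u < 1" "d > 0" for u d
    proof (cases u)
      case (real v)
      then have "1 / d * v < 1" using that by (simp flip: ennreal_mult ennreal_1 add: ennreal_less_iff)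
      then show ?thesis using real that by (simp add: field_simps ennreal_leI)
    qed (use that in \<open>auto simp: ennreal_mult_top\<close>)
    have R0: "?R p0 \<omega> \<le> ennreal b" using cancel[OF n1 b0] .
    have V: "V \<omega> \<le> ennreal (1 / c)" using cancel[of "1 / c" "V \<omega>"] n3 c0 by simp
    \<comment> \<open>Far from \<open>p0\<close>, within the moment set, the sample cannot fit
      \<open>q\<close> because it fits \<open>p0\<close>. So the indicator of this region may be
      replaced by the deviation functional divided by \<open>b\<close>, which bounds its share of
      the numerator by \<open>V / b\<close>.\<close>
    have big: "1 \<le> ennreal (1 / b) * ?R q \<omega>" if q: "q \<in> A" "q \<in> G" for q
    proof (rule ccontr)
      assume "\<not> ?thesis"
      then have "?R q \<omega> \<le> ennreal b" using cancel b0 by auto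
      then have "ennreal_rpow (wasserstein p (law q) (law p0)) p \<le>
          ennreal (4 powr p * (4 / \<delta>) * ((2 * (C + 4) + 2 * (2 powr (2 * p + \<delta>) * (1 + K))) * e))"
        using G[OF q(2)] R0 mom pos C0
        by (intro wasserstein_le_of_exp_dev_le[where n = n and x = "\<lambda>i. X i \<omega>"])
          (auto simp: P.real_distribution_axioms b_def x_def)
      then show False using A q by (auto simp: C_def)
    qed
    have [measurable]: "F - G \<in> sets \<mu>" using sets.compl_sets[OF Gm] by (simp add: sp)
    have DG: "(\<integral>\<^sup>+q\<in>F - G. ennreal (?LR q \<omega>) \<partial>\<mu>) + (\<integral>\<^sup>+q\<in>G. ennreal (?LR q \<omega>) \<partial>\<mu>) = ?D \<omega>"
      by (subst nn_integral_add[symmetric]) (auto intro!: nn_integral_cong simp: sp split: split_indicator)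
    have "(\<integral>\<^sup>+q\<in>A. ennreal (?LR q \<omega>) \<partial>\<mu>) \<le>
        (\<integral>\<^sup>+q. ennreal (?LR q \<omega>) * indicator (F - G) q + ennreal (1 / b) * (indicator G q * (ennreal (?LR q \<omega>) * ?R q \<omega>)) \<partial>\<mu>)"
    proof (rule nn_integral_mono)
      fix q assume "q \<in> space \<mu>"
      show "ennreal (?LR q \<omega>) * indicator A q \<le>
          ennreal (?LR q \<omega>) * indicator (F - G) q + ennreal (1 / b) * (indicator G q * (ennreal (?LR q \<omega>) * ?R q \<omega>))"
      proof (cases "q \<in> A \<and> q \<in> G")
        case True
        then have "ennreal (?LR q \<omega>) * 1 \<le> ennreal (?LR q \<omega>) * (ennreal (1 / b) * ?R q \<omega>)"
          using big by (intro mult_left_mono) auto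
        then show ?thesis using True by (simp add: ac_simps)
      next
        case False
        then show ?thesis using A by (auto simp: indicator_def)
      qed
    qed
    also have "\<dots> = (\<integral>\<^sup>+q\<in>F - G. ennreal (?LR q \<omega>) \<partial>\<mu>) + ennreal (1 / b) * V \<omega>"
      unfolding V_def by (subst nn_integral_add) (auto simp: nn_integral_cmult)
    also have "\<dots> \<le> (\<integral>\<^sup>+q\<in>F - G. ennreal (?LR q \<omega>) \<partial>\<mu>) + ennreal t * ?D \<omega>"
    proof (rule add_left_mono)
      have "ennreal (1 / b) * V \<omega> \<le> ennreal (1 / b) * ennreal (1 / c)"
        using V by (rule mult_left_mono) simp
      also have "\<dots> = ennreal (t * (exp (- (3 * x)) / 2))"
        using b0 c0 pos by (simp flip: ennreal_mult add: c_def exp_minus field_simps)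
      also have "\<dots> = ennreal t * ennreal (exp (- (3 * x)) / 2)"
        using pos by (intro ennreal_mult) auto
      also have "\<dots> \<le> ennreal t * ?D \<omega>" using n2 by (rule mult_left_mono) simp
      finally show "ennreal (1 / b) * V \<omega> \<le> ennreal t * ?D \<omega>" .
    qed
    finally have N: "(\<integral>\<^sup>+q\<in>A. ennreal (?LR q \<omega>) \<partial>\<mu>) \<le> (\<integral>\<^sup>+q\<in>F - G. ennreal (?LR q \<omega>) \<partial>\<mu>) + ennreal t * ?D \<omega>" .
    have "0 < ?D \<omega>" using n2 by (rule less_le_trans[rotated]) simp
    from enn2real_ratio_le[OF N DG this] show ?thesis
      using pos by (simp add: posterior_def)
  qed
  have ev: "?E1 \<in> events" "?E2 \<in> events" "?E3 \<in> events" by measurable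
  have "prob (?E1 \<union> ?E2 \<union> ?E3) \<le> prob ?E1 + prob ?E2 + prob ?E3"
    using measure_Un_le[OF sets.Un[OF ev(1,2)] ev(3)] measure_Un_le[OF ev(1,2)] by linarith
  also have "\<dots> \<le> 2 / x + 2 / x + 4 / t / x" using E1 E2 E3 by linarith
  also have "\<dots> = (4 + 4 / t) / (real n * e\<^sup>2)" by (simp add: x_def add_divide_distrib)
  finally show ?thesis
    using ev post by (intro that[of "?E1 \<union> ?E2 \<union> ?E3"]) (auto simp: G_def)
qed

section \<open>Passage to the limit in the sample size\<close>

lemma tendsto_zero_of_eventually_le:
  fixes f g :: "nat \<Rightarrow> real"
  assumes "\<And>n. 0 \<le> f n" "eventually (\<lambda>n. f n \<le> g n) sequentially" "g \<longlonglongrightarrow> 0"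
  shows "f \<longlonglongrightarrow> 0"
  by (rule tendsto_sandwich[OF _ assms(2) tendsto_const assms(3)]) (use assms(1) in simp)

theorem theorem3p2:
  fixes M :: "'w measure" and X :: "nat \<Rightarrow> 'w \<Rightarrow> real"
    and p0 :: "real \<Rightarrow> real" and F :: "(real \<Rightarrow> real) set"
    and \<mu> :: "nat \<Rightarrow> (real \<Rightarrow> real) measure"
    and p K \<delta> :: real and \<epsilon> :: "nat \<Rightarrow> real"
  assumes "prob_space M"
    and "prob_density p0"
    and "prob_space.indep_vars M (\<lambda>_. borel) X {1..}"
    and "\<And>i. i \<ge> 1 \<Longrightarrow> distr M borel (X i) = law p0"
    and "density_model F"
    and "\<And>n. n \<ge> 1 \<Longrightarrow> prior_on F (\<mu> n)"
    and "p \<ge> 1"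
    and "antimono_on {1..} \<epsilon>"
    and "\<epsilon> \<longlonglongrightarrow> 0"
    and "\<And>n. n \<ge> 1 \<Longrightarrow> \<epsilon> n \<ge> sqrt (ln (real n) / real n)"
    and "\<forall>\<^sub>F n in sequentially.
           measure (\<mu> n) (KL_nbhd F p0 (\<epsilon> n)) \<ge> exp (- (real n * (\<epsilon> n)\<^sup>2))"
    and "K > 0" and "\<delta> > 0"
    and "abs_moment (2 * p + \<delta>) (law p0) < \<infinity>"
    and "conv_in_prob M
           (\<lambda>n \<omega>. posterior p0 (\<mu> n) n (\<lambda>i. X i \<omega>)
              {q \<in> F. abs_moment (2 * p + \<delta>) (law q) \<le> ennreal K}) 1"
  shows "\<exists>K'>0. conv_in_prob M
           (\<lambda>n \<omega>. posterior p0 (\<mu> n) n (\<lambda>i. X i \<omega>)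
              {q \<in> F. ennreal_rpow (wasserstein p (law q) (law p0)) p
                 \<ge> ennreal (K' * (\<epsilon> n + (if p = 1 then \<epsilon> n * ln (1 / \<epsilon> n) else 0)))}) 0"
proof -
  interpret prob_space M by fact
  note p0 = assms(2) and ind = assms(3) and F = assms(5) and eps = assms(9,10)
  obtain K0 where K0: "abs_moment (2 * p + \<delta>) (law p0) = ennreal K0" "K0 \<ge> 0"
    using assms(14) by (cases "abs_moment (2 * p + \<delta>) (law p0)") auto
  \<comment> \<open>A moment bound common to the truth and the moment set; the moment set itself
    keeps the constant \<open>K\<close> of the hypothesis.\<close>
  define L where "L = max K K0"
  define C where "C = 2 powr (2 * p + \<delta>) * (1 + L)"
  define B where "B = 4 powr p * (4 / \<delta>) * (2 * (C + 4) + 2 * C)"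
  have L: "L \<ge> 0" "K \<le> L" "abs_moment (2 * p + \<delta>) (law p0) \<le> ennreal L"
    using K0 assms(12) by (auto simp: L_def)
  have B: "B \<ge> 0" using L assms(13) by (simp add: B_def C_def)
  have p0m: "p0 \<in> borel_measurable borel" using p0 by (simp add: prob_density_def)
  have indn: "indep_vars (\<lambda>_. borel) X {1..n}" for n
    using ind by (rule indep_vars_subset) auto
  have Xm: "X i \<in> borel_measurable M" if "i \<in> {1..n}" for i n
    using indn[of n] that by (auto simp: indep_vars_def)
  let ?A = "\<lambda>n. {q \<in> F. ennreal_rpow (wasserstein p (law q) (law p0)) p
       \<ge> ennreal ((B + 1) * (\<epsilon> n + (if p = 1 then \<epsilon> n * ln (1 / \<epsilon> n) else 0)))}"
  let ?G = "{q \<in> F. abs_moment (2 * p + \<delta>) (law q) \<le> ennreal K}"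
  let ?post = "\<lambda>n \<omega>. posterior p0 (\<mu> n) n (\<lambda>i. X i \<omega>)"
  have small: "eventually (\<lambda>n. \<epsilon> n < 1) sequentially"
    using eps(1) by (rule order_tendstoD) simp
  \<comment> \<open>The lower bound on \<open>\<epsilon> n\<close> gives
    \<open>n * (\<epsilon> n)\<^sup>2 \<ge> ln n\<close>, so error probabilities of order
    \<open>1 / (n * (\<epsilon> n)\<^sup>2)\<close> vanish.\<close>
  have rate: "filterlim (\<lambda>n. real n * (\<epsilon> n)\<^sup>2) at_top sequentially"
  proof (rule filterlim_at_top_mono)
    show "filterlim (\<lambda>n. ln (real n)) at_top sequentially"
      by (rule filterlim_compose[OF ln_at_top filterlim_real_sequentially])
    show "eventually (\<lambda>n. ln (real n) \<le> real n * (\<epsilon> n)\<^sup>2) sequentially"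
      using eventually_ge_at_top[of 1]
    proof eventually_elim
      case (elim n)
      have "(sqrt (ln (real n) / real n))\<^sup>2 \<le> (\<epsilon> n)\<^sup>2"
        using eps(2)[OF elim] elim by (intro power_mono) auto
      then show ?case using elim by (simp add: field_simps)
    qed
  qed
  have "conv_in_prob M (\<lambda>n \<omega>. ?post n \<omega> (?A n)) 0"
    unfolding conv_in_prob_def
  proof (intro allI impI)
    fix t :: real assume t: "t > 0"
    let ?N = "\<lambda>n. {\<omega> \<in> space M. \<bar>?post n \<omega> ?G - 1\<bar> > t / 2}"
    show "(\<lambda>n. prob {\<omega> \<in> space M. \<bar>?post n \<omega> (?A n) - 0\<bar> > t}) \<longlonglongrightarrow> 0"
    proof (rule tendsto_zero_of_eventually_le)
      show "(\<lambda>n. prob (?N n) + (4 + 4 / (t / 2)) / (real n * (\<epsilon> n)\<^sup>2)) \<longlonglongrightarrow> 0"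
      proof (rule tendsto_add_zero)
        show "(\<lambda>n. prob (?N n)) \<longlonglongrightarrow> 0"
          using assms(15) half_gt_zero[OF t] unfolding conv_in_prob_def by blast
        show "(\<lambda>n. (4 + 4 / (t / 2)) / (real n * (\<epsilon> n)\<^sup>2)) \<longlonglongrightarrow> 0"
          by (intro tendsto_divide_0[OF tendsto_const] filterlim_at_top_imp_at_infinity rate)
      qed
      show "eventually (\<lambda>n. prob {\<omega> \<in> space M. \<bar>?post n \<omega> (?A n) - 0\<bar> > t} \<le>
          prob (?N n) + (4 + 4 / (t / 2)) / (real n * (\<epsilon> n)\<^sup>2)) sequentially"
        using small assms(11) eventually_ge_at_top[of 2]
      proof eventually_elim
        case (elim n)
        then have n: "n \<ge> 1" by simp
        note \<mu> = assms(6)[OF n]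
        \<comment> \<open>Strict positivity needs \<open>n \<ge> 2\<close>, as
          \<open>ln 1 = 0\<close>.\<close>
        have "0 < sqrt (ln (real n) / real n)" using elim by simp
        then have e0: "\<epsilon> n > 0" using eps(2)[OF n] by linarith
        have sub: "?A n \<subseteq> {q \<in> F. ennreal_rpow (wasserstein p (law q) (law p0)) p >
            ennreal (4 powr p * (4 / \<delta>) * ((2 * (C + 4) + 2 * C) * \<epsilon> n))}"
        proof safe
          fix q assume q: "ennreal ((B + 1) * (\<epsilon> n + (if p = 1 then \<epsilon> n * ln (1 / \<epsilon> n) else 0))) \<le>
            ennreal_rpow (wasserstein p (law q) (law p0)) p"
          have eq: "4 powr p * (4 / \<delta>) * ((2 * (C + 4) + 2 * C) * \<epsilon> n) = B * \<epsilon> n" by (simp add: B_def)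
          \<comment> \<open>The additional 1 in the constant turns the non-strict inequality of the
            claim into a strict one. The logarithmic term is nonnegative because
            \<open>\<epsilon> n < 1\<close>, so for \<open>p = 1\<close> it only enlarges the
            radius.\<close>
          also have "\<dots> < (B + 1) * \<epsilon> n" using e0 by simp
          also have "\<dots> \<le> (B + 1) * (\<epsilon> n + (if p = 1 then \<epsilon> n * ln (1 / \<epsilon> n) else 0))"
            using e0 elim B by (intro mult_left_mono) auto
          finally have less: "4 powr p * (4 / \<delta>) * ((2 * (C + 4) + 2 * C) * \<epsilon> n) <
              (B + 1) * (\<epsilon> n + (if p = 1 then \<epsilon> n * ln (1 / \<epsilon> n) else 0))" .
          moreover have "0 \<le> 4 powr p * (4 / \<delta>) * ((2 * (C + 4) + 2 * C) * \<epsilon> n)"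
            unfolding eq using B e0 by simp
          ultimately have "ennreal (4 powr p * (4 / \<delta>) * ((2 * (C + 4) + 2 * C) * \<epsilon> n)) <
              ennreal ((B + 1) * (\<epsilon> n + (if p = 1 then \<epsilon> n * ln (1 / \<epsilon> n) else 0)))"
            by (intro ennreal_lessI) (rule le_less_trans)
          then show "ennreal (4 powr p * (4 / \<delta>) * ((2 * (C + 4) + 2 * C) * \<epsilon> n)) <
              ennreal_rpow (wasserstein p (law q) (law p0)) p"
            using q by (rule less_le_trans)
        qed
        have half: "t / 2 > 0" and Xd: "\<And>i. i \<in> {1..n} \<Longrightarrow> distr M borel (X i) = law p0"
          using t assms(4) by auto
        from posterior_wasserstein_bound[OF indn Xd p0 F \<mu> elim(2) e0 n assms(7,13) L(1) half L(3) L(2) sub[unfolded C_def]]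
        obtain E where E: "E \<in> events" "prob E \<le> (4 + 4 / (t / 2)) / (real n * (\<epsilon> n)\<^sup>2)"
          "\<And>\<omega>. \<omega> \<in> space M - E \<Longrightarrow> ?post n \<omega> (?A n) \<le> \<bar>?post n \<omega> ?G - 1\<bar> + t / 2"
          by blast
        have Nm: "?N n \<in> events"
        proof -
          have "?G \<in> sets (\<mu> n)"
            using \<mu> by (intro measurable_moment_set[OF F]) (simp add: prior_on_def)
          note [measurable] = borel_measurable_posterior[OF F \<mu> this p0m Xm]
          show ?thesis by measurable
        qed
        have "{\<omega> \<in> space M. \<bar>?post n \<omega> (?A n) - 0\<bar> > t} \<subseteq> ?N n \<union> E"
        proof
          fix \<omega> assume \<omega>: "\<omega> \<in> {\<omega> \<in> space M. \<bar>?post n \<omega> (?A n) - 0\<bar> > t}"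
          have "?post n \<omega> (?A n) \<ge> 0" by (simp add: posterior_def)
          then show "\<omega> \<in> ?N n \<union> E"
            using \<omega> E(3)[of \<omega>] by (cases "\<omega> \<in> E") auto
        qed
        \<comment> \<open>Monotonicity requires measurability of the larger set only, so the
          possibly non-measurable event on the left does no harm.\<close>
        then have "prob {\<omega> \<in> space M. \<bar>?post n \<omega> (?A n) - 0\<bar> > t} \<le> prob (?N n \<union> E)"
          using Nm E(1) by (intro finite_measure_mono) auto
        also have "\<dots> \<le> prob (?N n) + prob E"
          using Nm E(1) by (rule measure_Un_le)
        finally show ?case using E(2) by linarith
      qed
    qed simp
  qed
  then show ?thesis using B by (intro exI[of _ "B + 1"]) simp
qed

end
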